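(* Let $n\in\mathbb N$, let $u,v$ be weights on $\mathbb R^+=(0,\infty)$, let $a_0,\dots,a_n$ be measurable functions on $\mathbb R^+$, and let $$(\mathcal A f)(x)=\int_0^x\Big[\sum_{k=0}^n a_k(x)t^k\Big]f(t)\,dt,\qquad (\mathcal A_kf)(x)=a_k(x)\int_0^x t^kf(t)\,dt,\quad k=0,\dots,n .$$ Let $u^{-2}\in B_\delta$ for some $\delta\ge 0$. If $\delta>0$, assume in addition that $a_kv\in L_2(0,r)$ for all $r>0$ and $k=0,\dots,n-1$. Then for the operator $\mathcal A$ acting from $L_{2,u}$ into $L_{2,v}$ splitting takes place, that is, $$\mathcal A:L_{2,u}\to L_{2,v}\iff \mathcal A_k:L_{2,u}\to L_{2,v}\ \text{ for every } k=0,\dots,n.$$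
   Context: A weight is a nonnegative measurable function on $\mathbb R^+=(0,\infty)$. $L_{2,u}$ is the weighted space of functions $f$ on $\mathbb R^+$ with norm $\|uf\|_{L_2(\mathbb R^+)}$. For a linear operator $T$, the notation $T:L_{2,u}\to L_{2,v}$ means that there is a constant $C>0$ with $\|v\,Tf\|_{L_2(\mathbb R^+)}\le C\|uf\|_{L_2(\mathbb R^+)}$ for all $f\in L_{2,u}$. For $\delta\ge0$, $B_\delta$ denotes the set of positive locally summable functions $w$ on $\mathbb R^+$ for which there is a constant $D(w)$ such that $$\int_\Delta w(x)\,dx\le D(w)\int_{\frac12\Delta}w(x)\,dx$$ for every (bounded, nondegenerate) interval $\Delta\subset\mathbb R^+$ of length $|\Delta|\ge\delta$, where $\frac12\Delta$ is the interval of length $\frac12|\Delta|$ with the same center as $\Delta$. *)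

theory Defs
  imports "HOL-Analysis.Analysis"
begin

text \<open>
  Measurable means Lebesgue measurable. A function on the half-line $(0,\infty)$ is a total
  function on the reals whose values outside \<open>{0<..}\<close> are irrelevant.
\<close>

definition weight :: "(real \<Rightarrow> real) \<Rightarrow> bool" where
  "weight w \<longleftrightarrow> w \<in> borel_measurable (lebesgue_on {0<..}) \<and> (\<forall>x>0. 0 \<le> w x)"

definition L2 :: "real set \<Rightarrow> (real \<Rightarrow> real) set" where
  "L2 S = {f. f \<in> borel_measurable (lebesgue_on S) \<and> integrable (lebesgue_on S) (\<lambda>x. (f x)\<^sup>2)}"

definition norm_L2 :: "real set \<Rightarrow> (real \<Rightarrow> real) \<Rightarrow> real" where
  "norm_L2 S f = sqrt (LINT x|lebesgue_on S. (f x)\<^sup>2)"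

definition weighted_L2 :: "(real \<Rightarrow> real) \<Rightarrow> (real \<Rightarrow> real) set" where
  "weighted_L2 u =
     {f. f \<in> borel_measurable (lebesgue_on {0<..}) \<and> (\<lambda>x. u x * f x) \<in> L2 {0<..}}"

text \<open>
  The membership \<open>T f \<in> weighted_L2 v\<close> expresses that the left-hand norm is finite; without it,
  the Bochner integral in \<open>norm_L2\<close> would take the value 0 on a function that is not square
  integrable.
\<close>

definition acts_boundedly ::
    "((real \<Rightarrow> real) \<Rightarrow> real \<Rightarrow> real) \<Rightarrow> (real \<Rightarrow> real) \<Rightarrow> (real \<Rightarrow> real) \<Rightarrow> bool" where
  "acts_boundedly T u v \<longleftrightarrow>
     (\<exists>C>0. \<forall>f \<in> weighted_L2 u. T f \<in> weighted_L2 v \<and>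
        norm_L2 {0<..} (\<lambda>x. v x * T f x) \<le> C * norm_L2 {0<..} (\<lambda>x. u x * f x))"

definition locally_summable :: "(real \<Rightarrow> real) \<Rightarrow> bool" where
  "locally_summable w \<longleftrightarrow> (\<forall>K. compact K \<and> K \<subseteq> {0<..} \<longrightarrow> w absolutely_integrable_on K)"

text \<open>
  The interval \<open>{(3*a+b)/4 <..< (a+3*b)/4}\<close> has the centre of \<open>{a<..<b}\<close> and half its length.
  Intervals with left endpoint 0 are included. The integrals are taken in \<open>[0,\<infinity>]\<close>, so the
  inequality itself makes \<open>w\<close> summable up to 0. Omitting the endpoints does not change the
  integrals.
\<close>

definition B_class :: "real \<Rightarrow> (real \<Rightarrow> real) set" where
  "B_class \<delta> = {w. (\<forall>x>0. 0 < w x) \<and> locally_summable w \<and>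
     (\<exists>D. \<forall>a b. 0 \<le> a \<and> a < b \<and> \<delta> \<le> b - a \<longrightarrow>
        (\<integral>\<^sup>+x\<in>{a<..<b}. ennreal (w x) \<partial>lebesgue)
          \<le> ennreal D * (\<integral>\<^sup>+x\<in>{(3*a + b)/4 <..< (a + 3*b)/4}. ennreal (w x) \<partial>lebesgue))}"

definition poly_kernel_op ::
    "nat \<Rightarrow> (nat \<Rightarrow> real \<Rightarrow> real) \<Rightarrow> (real \<Rightarrow> real) \<Rightarrow> real \<Rightarrow> real" where
  "poly_kernel_op n a f x = (LINT t:{0<..<x}|lebesgue. (\<Sum>k\<le>n. a k x * t ^ k) * f t)"

definition monomial_op ::
    "(nat \<Rightarrow> real \<Rightarrow> real) \<Rightarrow> nat \<Rightarrow> (real \<Rightarrow> real) \<Rightarrow> real \<Rightarrow> real" where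
  "monomial_op a k f x = a k x * (LINT t:{0<..<x}|lebesgue. t ^ k * f t)"

end

theory Submission
  imports Defs "HOL-Computational_Algebra.Polynomial"
begin

text \<open>
  Write $w = u^{-2}$ and $W(r) = \int_0^r w$. Only $\mathcal A_k$ with $k < n$ need an argument, since
  $\mathcal A_n = \mathcal A - \sum_{k<n} \mathcal A_k$. By a weighted Hardy inequality, $\mathcal A_k$ is
  bounded as soon as $r^{2k} W(r) \int_r^\infty a_k^2 v^2$ is bounded in $r$. For large $r$ this follows
  by testing $\mathcal A$ on $w 1_I$ for $n + 1$ separated intervals $I \subset (0,r)$, each
  carrying, by doubling, a fixed proportion of $W(r)$: for $x > r$ the value $\mathcal A (w 1_I)(x)$ is $\int_I w$ times
  a value of the polynomial $\sum_k a_k(x) t^k$ at some point of the closure of $I$ (which depends on $x$), and a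
  polynomial of degree at most $n$ has its coefficients controlled by its values at $n + 1$
  separated points. For small $r$ (relevant only if $\delta > 0$) the condition $a_k v \in L_2(0,r)$ is used.
\<close>

text \<open>The coefficient bound therefore has one constant for all nodes in [0,1] with a
  prescribed gap. Substituting t = r s brings the nodes into [0,1] with a gap that depends on n
  alone, and turns the k-th coefficient into a_k(x) r^k; this is the source of the factor r^(2k).
  The exact Hardy condition would contain the integral of t^(2k) w over (0,r). The larger quantity
  r^(2k) W(r) is used instead: it comes from t^k \<le> r^k, and it is what the test functions bound
  directly, since doubling lets the mass of every test interval stand in for W(r). Doubling speaks
  only of intervals of length at least \<delta>, and the shortest test interval is a fixed fraction
  of (0,r). Hence testing reaches only r above a multiple of \<delta>, and the range below it has to
  be handled by integrability.\<close>

section \<open>Polynomial coefficients from values at separated nodes\<close>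

text \<open>Induction on the degree: split off one node by a divided difference.\<close>

lemma poly_coeff_bound_separated:
  fixes g :: real
  assumes "0 < g"
  shows "\<exists>K>0. \<forall>(p::real poly) \<tau> M. degree p \<le> n \<longrightarrow>
           (\<forall>i\<le>n. 0 \<le> \<tau> i \<and> \<tau> i \<le> 1 \<and> \<bar>poly p (\<tau> i)\<bar> \<le> M) \<longrightarrow>
           (\<forall>i\<le>n. \<forall>j<i. g \<le> \<bar>\<tau> i - \<tau> j\<bar>) \<longrightarrow> (\<forall>k. \<bar>coeff p k\<bar> \<le> K * M)"
proof (induction n)
  case 0
  have "\<bar>coeff p k\<bar> \<le> 1 * M" 
    if deg0: "degree p \<le> 0" and bd0: "\<forall>i\<le>0. 0 \<le> \<tau> i \<and> \<tau> i \<le> 1 \<and> \<bar>poly p (\<tau> i)\<bar> \<le> M"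
    for p :: "real poly" and \<tau> :: "nat \<Rightarrow> real" and M k
  proof -
    obtain c where "p = [:c:]"
      using le_zero_eq[THEN iffD1, OF deg0] degree_eq_zeroE[of p] by blast
    moreover have "\<bar>poly p (\<tau> 0)\<bar> \<le> M" using bd0 by blast
    ultimately show ?thesis by (cases k) auto
  qed
  then show ?case by (intro exI[of _ 1]) auto
next
  case (Suc n)
  then obtain K where "K > 0" and K: "\<And>(p::real poly) \<tau> M k. degree p \<le> n \<Longrightarrow>
      (\<And>i. i \<le> n \<Longrightarrow> 0 \<le> \<tau> i \<and> \<tau> i \<le> 1 \<and> \<bar>poly p (\<tau> i)\<bar> \<le> M) \<Longrightarrow>
      (\<And>i j. i \<le> n \<Longrightarrow> j < i \<Longrightarrow> g \<le> \<bar>\<tau> i - \<tau> j\<bar>) \<Longrightarrow> \<bar>coeff p k\<bar> \<le> K * M"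
    by (metis (no_types, lifting))
  \<comment> \<open>With p = p(s) + (X - s) q, the quotient q is at most 2M/g at the remaining
    nodes. Multiplication by X - s with s in [0,1] at most doubles its coefficient bound, which
    gives 4K/g; the 1 is for the constant p(s).\<close>
  have "\<bar>coeff p k\<bar> \<le> (1 + 4 * K / g) * M"
    if deg: "degree p \<le> Suc n"
      and bd: "\<forall>i\<le>Suc n. 0 \<le> \<tau> i \<and> \<tau> i \<le> 1 \<and> \<bar>poly p (\<tau> i)\<bar> \<le> M"
      and sep: "\<forall>i\<le>Suc n. \<forall>j<i. g \<le> \<bar>\<tau> i - \<tau> j\<bar>"
    for p :: "real poly" and \<tau> :: "nat \<Rightarrow> real" and M k
  proof -
    define s where "s = \<tau> (Suc n)"
    have s: "0 \<le> s" "s \<le> 1" "\<bar>poly p s\<bar> \<le> M" using bd by (auto simp: s_def)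
    have "[:-s, 1:] dvd p - [:poly p s:]"
      by (simp flip: poly_eq_0_iff_dvd)
    then obtain q where q: "p - [:poly p s:] = [:-s, 1:] * q" by (auto simp: dvd_def)
    have "degree ([:-s, 1:] * q) \<le> Suc n"
      unfolding q[symmetric] using deg by (intro degree_diff_le) auto
    then have degq: "degree q \<le> n"
      by (cases "q = 0") (auto simp: degree_mult_eq simp del: mult_pCons_left)
    have bq: "\<bar>coeff q k\<bar> \<le> K * (2 * M / g)" for k
    proof (rule K[OF degq, of \<tau>])
      fix i assume i: "i \<le> n"
      have "poly (p - [:poly p s:]) (\<tau> i) = (\<tau> i - s) * poly q (\<tau> i)"
        unfolding q by (simp add: algebra_simps)
      then have eq: "(\<tau> i - s) * poly q (\<tau> i) = poly p (\<tau> i) - poly p s" by simp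
      have "g \<le> \<bar>\<tau> i - s\<bar>" using sep i by (auto simp: s_def abs_minus_commute)
      then have "g * \<bar>poly q (\<tau> i)\<bar> \<le> \<bar>(\<tau> i - s) * poly q (\<tau> i)\<bar>"
        by (simp add: abs_mult mult_right_mono)
      also have "\<dots> \<le> 2 * M" unfolding eq using s(3) bd i by (smt (verit) le_SucI)
      finally show "0 \<le> \<tau> i \<and> \<tau> i \<le> 1 \<and> \<bar>poly q (\<tau> i)\<bar> \<le> 2 * M / g"
        using \<open>0 < g\<close> bd i by (auto simp: field_simps)
    qed (use sep in auto)
    have M0: "0 \<le> K * (2 * M / g)" using bq[of 0] by linarith
    have "p = [:poly p s:] + [:-s, 1:] * q" using q by (simp add: algebra_simps)
    then have "coeff p k = coeff [:poly p s:] k + coeff ([:-s, 1:] * q) k"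
      by (metis coeff_add)
    also have "coeff ([:-s, 1:] * q) k = - s * coeff q k + (if k = 0 then 0 else coeff q (k - 1))"
      by (cases k) auto
    finally have eq: "coeff p k = coeff [:poly p s:] k - s * coeff q k + (if k = 0 then 0 else coeff q (k - 1))"
      by simp
    have "\<bar>coeff [:poly p s:] k\<bar> \<le> M" using s(3) by (cases k) auto
    moreover have "\<bar>s * coeff q k\<bar> \<le> 1 * (K * (2 * M / g))"
      unfolding abs_mult using s bq by (intro mult_mono) auto
    moreover have "\<bar>if k = 0 then 0 else coeff q (k - 1)\<bar> \<le> K * (2 * M / g)"
      using bq M0 by auto
    ultimately have "\<bar>coeff p k\<bar> \<le> M + 2 * (K * (2 * M / g))"
      unfolding eq by linarith
    also have "\<dots> = (1 + 4 * K / g) * M" by (simp add: field_simps)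
    finally show ?thesis .
  qed
  moreover have "1 + 4 * K / g > 0" using \<open>K > 0\<close> \<open>0 < g\<close> by (simp add: add_pos_pos)
  ultimately show ?case by blast
qed

section \<open>A weighted Hardy inequality\<close>

abbreviation halfline :: "real measure" where "halfline \<equiv> lebesgue_on {0<..}"

lemma measurable_id_halfline [measurable]: "(\<lambda>x. x) \<in> borel_measurable halfline"
  by (intro measurable_restrict_space1 measurable_completion) simp

lemma nn_integral_halfline:
  "(\<integral>\<^sup>+x. f x \<partial>halfline) = (\<integral>\<^sup>+x\<in>{0<..}. f x \<partial>lebesgue)"
  by (subst nn_integral_restrict_space) auto

text \<open>All that is asked of the integral F is the Cauchy-Schwarz bound
  \<open>increment\<close>, whose factor \<open>V x\<close> depends on the right endpoint only. The
  tail of \<open>\<phi>\<close> starts at that same point, so the two meet in the product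
  \<open>muckenhoupt\<close>. Since the level sets are disjoint, the pieces of \<open>h\<close> add
  up to at most its whole integral.\<close>

lemma weighted_hardy_dyadic:
  fixes F :: "real \<Rightarrow> real" and \<phi> h V :: "real \<Rightarrow> ennreal" and B :: ennreal
  assumes cont: "continuous_on {0..} F" and F0: "F 0 = 0"
    and mono: "\<And>x y. 0 \<le> x \<Longrightarrow> x \<le> y \<Longrightarrow> F x \<le> F y"
    and [measurable]: "\<phi> \<in> borel_measurable halfline" "h \<in> borel_measurable halfline"
    and increment: "\<And>x y. 0 < y \<Longrightarrow> y < x \<Longrightarrow>
      ennreal ((F x - F y)\<^sup>2) \<le> V x * (\<integral>\<^sup>+t\<in>{y<..x}. h t \<partial>halfline)"
    and muckenhoupt: "\<And>x. 0 < x \<Longrightarrow> V x * (\<integral>\<^sup>+t\<in>{x<..}. \<phi> t \<partial>halfline) \<le> B"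
  shows "(\<integral>\<^sup>+x. \<phi> x * ennreal ((F x)\<^sup>2) \<partial>halfline) \<le> 16 * B * (\<integral>\<^sup>+x. h x \<partial>halfline)"
proof -
  text \<open>
    On the dyadic level set \<open>E j\<close> the function \<open>F\<close> is at most four times the increment of \<open>F\<close>
    across \<open>E (j - 1)\<close>; the constant 16 is the square of this four.
  \<close>
  define E where "E j = {x::real. 0 < x \<and> 2 powi j < F x \<and> F x \<le> 2 powi (j + 1)}" for j :: int
  have powi_Suc: "(2::real) powi (j + 1) = 2 * 2 powi j" for j :: int
    by (simp add: power_int_add_1')
  have contp: "continuous_on {0<..} F" using cont by (rule continuous_on_subset) auto
  have [measurable]: "F \<in> borel_measurable halfline"
    using contp by (intro continuous_imp_measurable_on_sets_lebesgue) auto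
  have Emeas[measurable]: "indicator (E j) \<in> borel_measurable halfline" for j
  proof -
    have "E j = {x \<in> space halfline. 2 powi j < F x \<and> F x \<le> 2 powi (j + 1)}"
      by (auto simp: E_def)
    also have "\<dots> \<in> sets halfline" by measurable
    finally show ?thesis by simp
  qed
  have Euniq: "i = j" if "x \<in> E i" "x \<in> E j" for x i j
  proof (rule ccontr)
    have *: False if "i < j" "x \<in> E i" "x \<in> E j" for i j :: int
    proof -
      have "(2::real) powi (i + 1) \<le> 2 powi j" using that(1) by (intro power_int_increasing) auto
      then show False using that by (auto simp: E_def)
    qed
    assume "i \<noteq> j" then show False using *[of i j] *[of j i] that by linarith
  qed
  have Eex: "\<exists>j. x \<in> E j" if "0 < x" "0 < F x" for x
  proof -
    \<comment> \<open>Ceiling minus one instead of floor, because \<open>E j\<close> is open below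
      and closed above: a value 2^i belongs to level i - 1.\<close>
    define j where "j = \<lceil>log 2 (F x)\<rceil> - 1"
    have "(2::real) powi j = 2 powr (real_of_int j)" "(2::real) powi (j+1) = 2 powr (real_of_int j + 1)"
      using powr_real_of_int'[of 2 j] powr_real_of_int'[of 2 "j + 1"] by simp_all
    moreover have "real_of_int j < log 2 (F x)" "log 2 (F x) \<le> real_of_int j + 1"
      unfolding j_def by linarith+
    ultimately have "x \<in> E j" using that
      by (auto simp: E_def less_log_iff log_le_iff)
    then show ?thesis ..
  qed
  have level: "(\<integral>\<^sup>+x. indicator (E j) x * (\<phi> x * ennreal ((F x)\<^sup>2)) \<partial>halfline)
      \<le> 16 * B * (\<integral>\<^sup>+x. indicator (E (j - 1)) x * h x \<partial>halfline)" (is "?L \<le> _") for j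
  proof (cases "E j = {}")
    case False
    define c :: real where "c = 2 powi (j - 1)"
    have c: "c > 0" "2 powi j = 2 * c" "2 powi (j+1) = 4 * c"
      using powi_Suc[of "j - 1"] powi_Suc[of j] by (auto simp: c_def)
    obtain z where z: "0 < z" "2 * c < F z" using False by (auto simp: E_def c)
    obtain x where x: "0 \<le> x" "F x = 2 * c"
      using IVT'[of F 0 "2 * c" z] z c F0 continuous_on_subset[OF cont, of "{0..z}"] by force
    have "0 < x" using x F0 c by (cases "x = 0") auto
    \<comment> \<open>The point y below is the last one in [0,x] with F \<le> c. Beyond it F exceeds
      c strictly, so all of (y,x] lies in \<open>E (j - 1)\<close> even if F has a plateau at height
      c.\<close>
    define S where "S = {t \<in> {0..x}. F t \<le> c}"
    have "compact S"
    proof -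
      have "continuous_on {0..x} F" using cont by (rule continuous_on_subset) auto
      then have "closed ({0..x} \<inter> F -` {..c})"
        by (intro continuous_closed_preimage) auto
      then have "compact ({0..x} \<inter> ({0..x} \<inter> F -` {..c}))"
        by (intro compact_Int_closed) auto
      moreover have "{0..x} \<inter> ({0..x} \<inter> F -` {..c}) = S" by (auto simp: S_def)
      ultimately show ?thesis by simp
    qed
    obtain y0 where y0: "0 \<le> y0" "y0 \<le> x" "F y0 = c"
      using IVT'[of F 0 c x] x c F0 continuous_on_subset[OF cont, of "{0..x}"] by force
    then have "S \<noteq> {}" by (auto simp: S_def)
    then obtain y where y: "y \<in> S" and ymax: "\<And>t. t \<in> S \<Longrightarrow> t \<le> y"
      using compact_attains_sup[OF \<open>compact S\<close>] by auto
    have "y0 \<in> S" using y0 by (auto simp: S_def)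
    then have "F y = c" using ymax[of y0] mono[of y0 y] y0 y by (auto simp: S_def)
    have "0 < y" using \<open>F y = c\<close> F0 c y by (cases "y = 0") (auto simp: S_def)
    have "y < x" using y x \<open>F y = c\<close> c by (cases "y = x") (auto simp: S_def)
    have sub: "t \<in> E (j - 1)" if "y < t" "t \<le> x" for t
      using that ymax[of t] mono[of t x] x \<open>0 < y\<close> by (force simp: E_def S_def c c_def[symmetric])
    have Ex: "x < t" if "t \<in> E j" for t
      using that mono[of t x] x by (force simp: E_def c)
    have hsub: "(\<integral>\<^sup>+t\<in>{y<..x}. h t \<partial>halfline) \<le> (\<integral>\<^sup>+t. indicator (E (j - 1)) t * h t \<partial>halfline)"
      using sub by (intro nn_integral_mono) (auto simp: indicator_def)
    have "?L \<le> (\<integral>\<^sup>+t. ennreal (16 * c\<^sup>2) * (\<phi> t * indicator {x<..} t) \<partial>halfline)"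
    proof (intro nn_integral_mono)
      fix t assume "t \<in> space halfline"
      have "(F t)\<^sup>2 \<le> 16 * c\<^sup>2" if "t \<in> E j"
      proof -
        have "(F t)\<^sup>2 \<le> (4 * c)\<^sup>2" using that c by (intro power_mono) (auto simp: E_def)
        then show ?thesis by (simp add: power_mult_distrib)
      qed
      then show "indicator (E j) t * (\<phi> t * ennreal ((F t)\<^sup>2)) \<le> ennreal (16 * c\<^sup>2) * (\<phi> t * indicator {x<..} t)"
        using Ex[of t] by (auto simp: indicator_def mult.commute intro!: mult_left_mono ennreal_leI)
    qed
    also have "\<dots> = 16 * (ennreal (c\<^sup>2) * (\<integral>\<^sup>+t\<in>{x<..}. \<phi> t \<partial>halfline))"
      by (subst nn_integral_cmult) (auto simp: ennreal_mult mult.assoc)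
    also have "\<dots> \<le> 16 * ((V x * (\<integral>\<^sup>+t\<in>{y<..x}. h t \<partial>halfline)) * (\<integral>\<^sup>+t\<in>{x<..}. \<phi> t \<partial>halfline))"
      using increment[OF \<open>0 < y\<close> \<open>y < x\<close>] x \<open>F y = c\<close>
      by (intro mult_left_mono mult_right_mono) auto
    also have "\<dots> = 16 * ((V x * (\<integral>\<^sup>+t\<in>{x<..}. \<phi> t \<partial>halfline)) * (\<integral>\<^sup>+t\<in>{y<..x}. h t \<partial>halfline))"
      by (simp add: ac_simps)
    also have "\<dots> \<le> 16 * (B * (\<integral>\<^sup>+t. indicator (E (j - 1)) t * h t \<partial>halfline))"
      by (intro mult_left_mono mult_mono muckenhoupt \<open>0 < x\<close> hsub) auto
    finally show ?thesis by (simp add: ac_simps)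
  qed simp
  have "(\<integral>\<^sup>+x. \<phi> x * ennreal ((F x)\<^sup>2) \<partial>halfline)
     = (\<integral>\<^sup>+x. (\<integral>\<^sup>+j. indicator (E j) x * (\<phi> x * ennreal ((F x)\<^sup>2)) \<partial>count_space UNIV) \<partial>halfline)"
  proof (intro nn_integral_cong)
    fix x assume "x \<in> space halfline"
    then have x: "0 < x" by simp
    show "\<phi> x * ennreal ((F x)\<^sup>2)
      = (\<integral>\<^sup>+j. indicator (E j) x * (\<phi> x * ennreal ((F x)\<^sup>2)) \<partial>count_space UNIV)"
    \<comment> \<open>Points with F x = 0 lie in no level set, but there the integrand
      vanishes.\<close>
    proof (cases "F x = 0")
      case False
      then have "0 < F x" using mono[of 0 x] x F0 by auto
      then obtain i where i: "x \<in> E i" using Eex x by blast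
      have "(\<integral>\<^sup>+j. indicator (E j) x * (\<phi> x * ennreal ((F x)\<^sup>2)) \<partial>count_space UNIV)
         = (\<Sum>j\<in>{i}. indicator (E j) x * (\<phi> x * ennreal ((F x)\<^sup>2)))"
        using Euniq[OF i] by (intro nn_integral_count_space') (auto simp: indicator_def)
      then show ?thesis using i by simp
    qed simp
  qed
  also have "\<dots> = (\<integral>\<^sup>+j. (\<integral>\<^sup>+x. indicator (E j) x * (\<phi> x * ennreal ((F x)\<^sup>2)) \<partial>halfline) \<partial>count_space UNIV)"
    by (intro nn_integral_count_space_nn_integral) auto
  also have "\<dots> \<le> (\<integral>\<^sup>+j. 16 * B * (\<integral>\<^sup>+x. indicator (E (j - 1)) x * h x \<partial>halfline) \<partial>count_space UNIV)"
    by (intro nn_integral_mono level)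
  also have "\<dots> = 16 * B * (\<integral>\<^sup>+j. (\<integral>\<^sup>+x. indicator (E (j - 1)) x * h x \<partial>halfline) \<partial>count_space UNIV)"
    by (intro nn_integral_cmult) auto
  also have "(\<integral>\<^sup>+j. (\<integral>\<^sup>+x. indicator (E (j - 1)) x * h x \<partial>halfline) \<partial>count_space UNIV)
     = (\<integral>\<^sup>+x. (\<integral>\<^sup>+j. indicator (E (j - 1)) x * h x \<partial>count_space UNIV) \<partial>halfline)"
    by (intro nn_integral_count_space_nn_integral[symmetric]) auto
  also have "\<dots> \<le> (\<integral>\<^sup>+x. h x \<partial>halfline)"
  proof (intro nn_integral_mono)
    fix x
    show "(\<integral>\<^sup>+j. indicator (E (j - 1)) x * h x \<partial>count_space UNIV) \<le> h x"
    proof (cases "\<exists>i. x \<in> E i")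
      case True
      then obtain i where i: "x \<in> E i" ..
      have "(\<integral>\<^sup>+j. indicator (E (j - 1)) x * h x \<partial>count_space UNIV)
         = (\<Sum>j\<in>{i + 1}. indicator (E (j - 1)) x * h x)"
        using Euniq[OF i] by (intro nn_integral_count_space') (force simp: indicator_def)+
      then show ?thesis using i by simp
    qed simp
  qed
  finally show ?thesis by (simp add: mult_left_mono)
qed

section \<open>Boundedness in terms of nonnegative integrals\<close>

lemma in_L2_iff:
  "f \<in> L2 {0<..} \<longleftrightarrow> f \<in> borel_measurable halfline \<and> (\<integral>\<^sup>+x. ennreal ((f x)\<^sup>2) \<partial>halfline) < \<infinity>"
  unfolding L2_def by (auto simp: integrable_iff_bounded)

lemma nn_integral_square_eq_norm_L2:
  "f \<in> L2 {0<..} \<Longrightarrow> (\<integral>\<^sup>+x. ennreal ((f x)\<^sup>2) \<partial>halfline) = ennreal ((norm_L2 {0<..} f)\<^sup>2)"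
  unfolding L2_def norm_L2_def by (auto simp: nn_integral_eq_integral)

text \<open>Squared norms in [0,\<infinity>] can be estimated without integrability checks.
  Finiteness of the right side for f in \<open>weighted_L2 u\<close> gives back the membership of
  \<open>T f\<close> in \<open>weighted_L2 v\<close>, so measurability is the only side condition to
  carry along.\<close>

lemma acts_boundedly_iff_nn_integral:
  assumes [measurable]: "v \<in> borel_measurable halfline"
  shows "acts_boundedly T u v \<longleftrightarrow> (\<exists>C::real. \<forall>f \<in> weighted_L2 u. T f \<in> borel_measurable halfline \<and>
     (\<integral>\<^sup>+x. ennreal ((v x * T f x)\<^sup>2) \<partial>halfline) \<le> ennreal C * (\<integral>\<^sup>+x. ennreal ((u x * f x)\<^sup>2) \<partial>halfline))"
proof
  assume "acts_boundedly T u v"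
  then obtain C where "C > 0" and C: "\<And>f. f \<in> weighted_L2 u \<Longrightarrow> T f \<in> weighted_L2 v \<and>
        norm_L2 {0<..} (\<lambda>x. v x * T f x) \<le> C * norm_L2 {0<..} (\<lambda>x. u x * f x)"
    unfolding acts_boundedly_def by blast
  show "\<exists>C::real. \<forall>f \<in> weighted_L2 u. T f \<in> borel_measurable halfline \<and>
     (\<integral>\<^sup>+x. ennreal ((v x * T f x)\<^sup>2) \<partial>halfline) \<le> ennreal C * (\<integral>\<^sup>+x. ennreal ((u x * f x)\<^sup>2) \<partial>halfline)"
  proof (intro exI[of _ "C\<^sup>2"] ballI conjI)
    fix f assume f: "f \<in> weighted_L2 u"
    show "T f \<in> borel_measurable halfline" using C[OF f] by (simp add: weighted_L2_def)
    have "(\<lambda>x. v x * T f x) \<in> L2 {0<..}" "(\<lambda>x. u x * f x) \<in> L2 {0<..}"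
      using C[OF f] f by (auto simp: weighted_L2_def)
    note eq = this[THEN nn_integral_square_eq_norm_L2]
    have "0 \<le> norm_L2 {0<..} (\<lambda>x. v x * T f x)" by (auto simp: norm_L2_def)
    then have "(norm_L2 {0<..} (\<lambda>x. v x * T f x))\<^sup>2 \<le> (C * norm_L2 {0<..} (\<lambda>x. u x * f x))\<^sup>2"
      using C[OF f] by (intro power_mono) auto
    then show "(\<integral>\<^sup>+x. ennreal ((v x * T f x)\<^sup>2) \<partial>halfline) \<le> ennreal (C\<^sup>2) * (\<integral>\<^sup>+x. ennreal ((u x * f x)\<^sup>2) \<partial>halfline)"
      unfolding eq by (auto simp: power_mult_distrib ennreal_leI simp flip: ennreal_mult)
  qed
next
  assume "\<exists>C::real. \<forall>f \<in> weighted_L2 u. T f \<in> borel_measurable halfline \<and>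
     (\<integral>\<^sup>+x. ennreal ((v x * T f x)\<^sup>2) \<partial>halfline) \<le> ennreal C * (\<integral>\<^sup>+x. ennreal ((u x * f x)\<^sup>2) \<partial>halfline)"
  then obtain C :: real where C: "\<And>f. f \<in> weighted_L2 u \<Longrightarrow> T f \<in> borel_measurable halfline"
     "\<And>f. f \<in> weighted_L2 u \<Longrightarrow>
     (\<integral>\<^sup>+x. ennreal ((v x * T f x)\<^sup>2) \<partial>halfline) \<le> ennreal C * (\<integral>\<^sup>+x. ennreal ((u x * f x)\<^sup>2) \<partial>halfline)"
    by blast
  \<comment> \<open>\<open>acts_boundedly\<close> requires a positive constant, while C may be zero
    or negative.\<close>
  define K where "K = max C 1"
  show "acts_boundedly T u v"
    unfolding acts_boundedly_def
  proof (intro exI[of _ "sqrt K"] ballI conjI)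
    show "sqrt K > 0" by (simp add: K_def)
    fix f assume f: "f \<in> weighted_L2 u"
    have [measurable]: "T f \<in> borel_measurable halfline" using C(1)[OF f] .
    have u: "(\<lambda>x. u x * f x) \<in> L2 {0<..}" using f by (auto simp: weighted_L2_def)
    have le: "(\<integral>\<^sup>+x. ennreal ((v x * T f x)\<^sup>2) \<partial>halfline) \<le> ennreal (K * (norm_L2 {0<..} (\<lambda>x. u x * f x))\<^sup>2)"
    proof -
      have "(\<integral>\<^sup>+x. ennreal ((v x * T f x)\<^sup>2) \<partial>halfline) \<le> ennreal K * (\<integral>\<^sup>+x. ennreal ((u x * f x)\<^sup>2) \<partial>halfline)"
        using C(2)[OF f] by (rule order_trans) (auto intro!: mult_right_mono ennreal_leI simp: K_def)
      then show ?thesis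
        by (simp add: nn_integral_square_eq_norm_L2[OF u] ennreal_mult K_def)
    qed
    then have v: "(\<lambda>x. v x * T f x) \<in> L2 {0<..}"
      unfolding in_L2_iff by (auto intro: le_less_trans)
    then show "T f \<in> weighted_L2 v" by (auto simp: weighted_L2_def)
    have "(norm_L2 {0<..} (\<lambda>x. v x * T f x))\<^sup>2 \<le> K * (norm_L2 {0<..} (\<lambda>x. u x * f x))\<^sup>2"
      using le by (subst (asm) nn_integral_square_eq_norm_L2[OF v], subst (asm) ennreal_le_iff) (auto simp: K_def)
    then have "norm_L2 {0<..} (\<lambda>x. v x * T f x) \<le> sqrt (K * (norm_L2 {0<..} (\<lambda>x. u x * f x))\<^sup>2)"
      by (rule real_le_rsqrt)
    then show "norm_L2 {0<..} (\<lambda>x. v x * T f x) \<le> sqrt K * norm_L2 {0<..} (\<lambda>x. u x * f x)"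
      by (simp add: real_sqrt_mult norm_L2_def)
  qed
qed

text \<open>The identity is asked only on \<open>weighted_L2 u\<close> and for x > 0, because the
  integral of a sum splits only when the terms are integrable. The choices c = 1 and c = -1 add and
  remove a monomial operator; c = 0 replaces an operator by one that agrees with it there.\<close>

lemma acts_boundedly_linear_combination:
  assumes v[measurable]: "v \<in> borel_measurable halfline"
    and "acts_boundedly T1 u v" "acts_boundedly T2 u v"
    and eq: "\<And>f x. f \<in> weighted_L2 u \<Longrightarrow> 0 < x \<Longrightarrow> T f x = T1 f x + c * T2 f x"
  shows "acts_boundedly T u v"
proof -
  obtain C1 :: real where 1: "\<And>f. f \<in> weighted_L2 u \<Longrightarrow> T1 f \<in> borel_measurable halfline"
     "\<And>f. f \<in> weighted_L2 u \<Longrightarrow>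
     (\<integral>\<^sup>+x. ennreal ((v x * T1 f x)\<^sup>2) \<partial>halfline) \<le> ennreal C1 * (\<integral>\<^sup>+x. ennreal ((u x * f x)\<^sup>2) \<partial>halfline)"
    using assms(2) unfolding acts_boundedly_iff_nn_integral[OF v] by blast
  obtain C2 :: real where 2: "\<And>f. f \<in> weighted_L2 u \<Longrightarrow> T2 f \<in> borel_measurable halfline"
     "\<And>f. f \<in> weighted_L2 u \<Longrightarrow>
     (\<integral>\<^sup>+x. ennreal ((v x * T2 f x)\<^sup>2) \<partial>halfline) \<le> ennreal C2 * (\<integral>\<^sup>+x. ennreal ((u x * f x)\<^sup>2) \<partial>halfline)"
    using assms(3) unfolding acts_boundedly_iff_nn_integral[OF v] by blast
  show ?thesis
    unfolding acts_boundedly_iff_nn_integral[OF v]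
  proof (intro exI[of _ "2 * max C1 0 + 2 * c\<^sup>2 * max C2 0"] ballI conjI)
    fix f assume f: "f \<in> weighted_L2 u"
    note [measurable] = 1(1)[OF f] 2(1)[OF f]
    have "(\<lambda>x. T1 f x + c * T2 f x) \<in> borel_measurable halfline" by measurable
    then show "T f \<in> borel_measurable halfline"
      by (rule measurable_cong[THEN iffD1, rotated]) (auto simp: eq[OF f])
    have "(\<integral>\<^sup>+x. ennreal ((v x * T f x)\<^sup>2) \<partial>halfline)
      \<le> (\<integral>\<^sup>+x. ennreal 2 * ennreal ((v x * T1 f x)\<^sup>2) + ennreal (2 * c\<^sup>2) * ennreal ((v x * T2 f x)\<^sup>2) \<partial>halfline)"
    proof (intro nn_integral_mono)
      fix x assume "x \<in> space halfline"
      then have "v x * T f x = v x * T1 f x + c * (v x * T2 f x)"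
        by (simp add: eq[OF f] algebra_simps)
      moreover have "(p + c * q)\<^sup>2 \<le> 2 * p\<^sup>2 + (2 * c\<^sup>2) * q\<^sup>2" for p q :: real
        using zero_le_power2[of "p - c * q"] by (simp add: power2_eq_square algebra_simps)
      ultimately have "ennreal ((v x * T f x)\<^sup>2)
        \<le> ennreal (2 * (v x * T1 f x)\<^sup>2 + (2 * c\<^sup>2) * (v x * T2 f x)\<^sup>2)"
        by (intro ennreal_leI) presburger
      also have "\<dots> = ennreal 2 * ennreal ((v x * T1 f x)\<^sup>2) + ennreal (2 * c\<^sup>2) * ennreal ((v x * T2 f x)\<^sup>2)"
        by (subst ennreal_plus; (subst ennreal_mult)?) (auto simp: ennreal_mult)
      finally show "ennreal ((v x * T f x)\<^sup>2)
        \<le> ennreal 2 * ennreal ((v x * T1 f x)\<^sup>2) + ennreal (2 * c\<^sup>2) * ennreal ((v x * T2 f x)\<^sup>2)" .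
    qed
    also have "\<dots> = ennreal 2 * (\<integral>\<^sup>+x. ennreal ((v x * T1 f x)\<^sup>2) \<partial>halfline)
        + ennreal (2 * c\<^sup>2) * (\<integral>\<^sup>+x. ennreal ((v x * T2 f x)\<^sup>2) \<partial>halfline)"
      by (subst nn_integral_add) (auto simp: nn_integral_cmult)
    also have "\<dots> \<le> ennreal 2 * (ennreal (max C1 0) * (\<integral>\<^sup>+x. ennreal ((u x * f x)\<^sup>2) \<partial>halfline))
        + ennreal (2 * c\<^sup>2) * (ennreal (max C2 0) * (\<integral>\<^sup>+x. ennreal ((u x * f x)\<^sup>2) \<partial>halfline))"
      by (intro add_mono mult_left_mono order_trans[OF 1(2)[OF f]] order_trans[OF 2(2)[OF f]]
           mult_right_mono ennreal_leI) auto
    also have "\<dots> = ennreal (2 * max C1 0 + 2 * c\<^sup>2 * max C2 0) * (\<integral>\<^sup>+x. ennreal ((u x * f x)\<^sup>2) \<partial>halfline)"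
      by (simp add: ennreal_plus ennreal_mult distrib_right mult.assoc)
    finally show "(\<integral>\<^sup>+x. ennreal ((v x * T f x)\<^sup>2) \<partial>halfline)
      \<le> ennreal (2 * max C1 0 + 2 * c\<^sup>2 * max C2 0) * (\<integral>\<^sup>+x. ennreal ((u x * f x)\<^sup>2) \<partial>halfline)" .
  qed
qed

section \<open>Integrals over intervals, their continuity, and Cauchy-Schwarz\<close>

lemma set_nn_integral_halfline:
  "A \<subseteq> {0<..} \<Longrightarrow> (\<integral>\<^sup>+t\<in>A. f t \<partial>halfline) = (\<integral>\<^sup>+t\<in>A. f t \<partial>lebesgue)"
  by (subst nn_integral_halfline) (auto intro!: nn_integral_cong split: split_indicator)

lemma set_integrable_halflineI:
  fixes g :: "real \<Rightarrow> real"
  assumes g: "g \<in> borel_measurable halfline" and A: "A \<in> sets borel" "A \<subseteq> {0<..}"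
    and fin: "(\<integral>\<^sup>+t\<in>A. ennreal \<bar>g t\<bar> \<partial>halfline) < \<infinity>"
  shows "set_integrable lebesgue A g"
proof -
  have A': "A \<in> sets lebesgue" using A(1) by simp
  have "g \<in> borel_measurable (lebesgue_on A)"
    using measurable_restrict_mono[OF g A(2)] .
  then have "(\<lambda>x. indicator A x *\<^sub>R g x) \<in> borel_measurable lebesgue"
    using A' by (subst (asm) borel_measurable_restrict_space_iff) auto
  moreover have "(\<integral>\<^sup>+x. ennreal (norm (indicator A x *\<^sub>R g x)) \<partial>lebesgue) = (\<integral>\<^sup>+t\<in>A. ennreal \<bar>g t\<bar> \<partial>lebesgue)"
    by (intro nn_integral_cong) (auto split: split_indicator)
  ultimately show ?thesis
    using fin unfolding set_integrable_def
    by (intro integrableI_bounded) (auto simp: set_nn_integral_halfline[OF A(2)])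
qed

text \<open>Links the open intervals of the operators, and the half-open ones used for increments,
  to closed intervals, where continuity of the indefinite integral is known. The endpoints are
  negligible.\<close>

lemma set_integral_eq_Icc:
  fixes g :: "real \<Rightarrow> real"
  assumes g: "set_integrable lebesgue S g" and S: "{0<..<x} \<subseteq> S" "S \<subseteq> {0..x}"
  shows "(LINT t:S|lebesgue. g t) = integral {0..x} g"
proof -
  have "integral S g = integral {0..x} g"
  proof (rule integral_spike_set)
    have "{0..x} \<subseteq> {0<..<x} \<union> {0, x}" by auto
    then have "S - {0..x} \<subseteq> {0, x}" "{0..x} - S \<subseteq> {0, x}" using S by blast+
    then show "negligible {t \<in> S - {0..x}. g t \<noteq> 0}" "negligible {t \<in> {0..x} - S. g t \<noteq> 0}"
      by (blast intro: negligible_subset[of "{0, x}"] negligible_finite)+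
  qed
  then show ?thesis using set_lebesgue_integral_eq_integral(2)[OF g] by simp
qed

lemma continuous_on_set_integral_Ioo:
  fixes g :: "real \<Rightarrow> real"
  assumes g: "\<And>x. set_integrable lebesgue {0<..<x} g"
  shows "continuous_on {0..} (\<lambda>x. LINT t:{0<..<x}|lebesgue. g t)"
  unfolding continuous_on_eq_continuous_within
proof
  fix x :: real assume x: "x \<in> {0..}"
  \<comment> \<open>Continuity at x is local, so a bounded interval suffices; the added 1 keeps x
    away from its right end.\<close>
  have "g absolutely_integrable_on {0..x + 1}"
    using g[of "x + 1"] by (simp add: absolutely_integrable_on_Icc_iff_Ioo)
  then have "continuous_on {0..x+1} (\<lambda>y. integral {0..y} g)"
    by (intro indefinite_integral_continuous_1 set_lebesgue_integral_eq_integral(1))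
  then have "continuous_on {0..x+1} (\<lambda>y. LINT t:{0<..<y}|lebesgue. g t)"
    by (rule continuous_on_eq) (auto intro!: set_integral_eq_Icc[symmetric] g)
  moreover have "at x within {0..} = at x within {0..x+1}"
    by (rule at_within_nhd[of _ "{..<x+1}"]) auto
  ultimately show "continuous (at x within {0..}) (\<lambda>y. LINT t:{0<..<y}|lebesgue. g t)"
    using x by (auto simp: continuous_on_eq_continuous_within continuous_within)
qed

lemma borel_measurable_set_integral_Ioo:
  fixes g :: "real \<Rightarrow> real"
  assumes g: "\<And>x. set_integrable lebesgue {0<..<x} g"
  shows "(\<lambda>x. LINT t:{0<..<x}|lebesgue. g t) \<in> borel_measurable halfline"
  by (intro continuous_imp_measurable_on_sets_lebesgue
      continuous_on_subset[OF continuous_on_set_integral_Ioo[OF g]]) auto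

text \<open>Factor |f| as |1/u| times |u f|.\<close>

lemma weighted_Cauchy_Schwarz:
  fixes u f :: "real \<Rightarrow> real"
  assumes [measurable]: "u \<in> borel_measurable halfline" "f \<in> borel_measurable halfline" "A \<in> sets borel"
    and u: "\<And>x. 0 < x \<Longrightarrow> u x \<noteq> 0"
  shows "(\<integral>\<^sup>+t\<in>A. ennreal \<bar>f t\<bar> \<partial>halfline)\<^sup>2 \<le>
    (\<integral>\<^sup>+t\<in>A. ennreal (inverse ((u t)\<^sup>2)) \<partial>halfline) * (\<integral>\<^sup>+t\<in>A. ennreal ((u t * f t)\<^sup>2) \<partial>halfline)"
proof -
  have ind[measurable]: "(indicator A :: real \<Rightarrow> ennreal) \<in> borel_measurable halfline"
    by (rule measurable_compose[OF measurable_id_halfline]) simp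
  have "(\<integral>\<^sup>+t\<in>A. ennreal \<bar>f t\<bar> \<partial>halfline)
     = (\<integral>\<^sup>+t. (ennreal \<bar>inverse (u t)\<bar> * indicator A t) * (ennreal \<bar>u t * f t\<bar> * indicator A t) \<partial>halfline)"
  proof (intro nn_integral_cong)
    fix t assume "t \<in> space halfline"
    then have "\<bar>inverse (u t)\<bar> * \<bar>u t * f t\<bar> = \<bar>f t\<bar>"
      using u[of t] by (simp add: abs_mult)
    then have "ennreal \<bar>inverse (u t)\<bar> * ennreal \<bar>u t * f t\<bar> = ennreal \<bar>f t\<bar>"
      by (metis abs_ge_zero ennreal_mult)
    then show "ennreal \<bar>f t\<bar> * indicator A t
      = (ennreal \<bar>inverse (u t)\<bar> * indicator A t) * (ennreal \<bar>u t * f t\<bar> * indicator A t)"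
      by (cases "t \<in> A") auto
  qed
  also have "\<dots>\<^sup>2 \<le> (\<integral>\<^sup>+t. (ennreal \<bar>inverse (u t)\<bar> * indicator A t)\<^sup>2 \<partial>halfline) *
      (\<integral>\<^sup>+t. (ennreal \<bar>u t * f t\<bar> * indicator A t)\<^sup>2 \<partial>halfline)"
    by (intro Cauchy_Schwarz_nn_integral) measurable
  also have "(\<integral>\<^sup>+t. (ennreal \<bar>inverse (u t)\<bar> * indicator A t)\<^sup>2 \<partial>halfline)
      = (\<integral>\<^sup>+t\<in>A. ennreal (inverse ((u t)\<^sup>2)) \<partial>halfline)"
    by (intro nn_integral_cong) (auto simp: ennreal_power power_inverse split: split_indicator)
  also have "(\<integral>\<^sup>+t. (ennreal \<bar>u t * f t\<bar> * indicator A t)\<^sup>2 \<partial>halfline)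
      = (\<integral>\<^sup>+t\<in>A. ennreal ((u t * f t)\<^sup>2) \<partial>halfline)"
    by (intro nn_integral_cong) (auto simp: ennreal_power split: split_indicator)
  finally show ?thesis .
qed

text \<open>The measure with density w = u^(-2). It takes values in [0,\<infinity>], so that
  doubling can be applied before finiteness is known, and indeed to prove finiteness.\<close>

definition mass :: "(real \<Rightarrow> real) \<Rightarrow> real set \<Rightarrow> ennreal" where
  "mass u A = (\<integral>\<^sup>+t\<in>A. ennreal (inverse ((u t)\<^sup>2)) \<partial>halfline)"

lemma mass_mono: "A \<subseteq> B \<Longrightarrow> mass u A \<le> mass u B"
  unfolding mass_def by (intro nn_integral_mono) (auto split: split_indicator)

lemma mass_Ioc: "0 \<le> y \<Longrightarrow> mass u {y<..x} = mass u {y<..<x}"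
proof -
  assume "0 \<le> y"
  have "AE t in lebesgue. t \<notin> {x}"
    by (rule AE_not_in) (simp flip: negligible_iff_null_sets)
  then have "(\<integral>\<^sup>+t\<in>{y<..x}. ennreal (inverse ((u t)\<^sup>2)) \<partial>lebesgue) = (\<integral>\<^sup>+t\<in>{y<..<x}. ennreal (inverse ((u t)\<^sup>2)) \<partial>lebesgue)"
    by (intro nn_integral_cong_AE) (auto elim!: eventually_mono split: split_indicator)
  then show ?thesis
    using \<open>0 \<le> y\<close> unfolding mass_def by (subst (1 2) set_nn_integral_halfline) auto
qed

section \<open>Moments of f and the sufficient condition for a monomial operator\<close>

text \<open>Finite mass up to 0 makes t^k f integrable on (0,x) for every f in
  \<open>weighted_L2 u\<close>. The integrals in the operators are then genuine ones and not the
  default value 0 of the Bochner integral.\<close>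

locale inverse_square_weight =
  fixes u :: "real \<Rightarrow> real"
  assumes u_measurable [measurable]: "u \<in> borel_measurable halfline"
    and u_nonzero: "0 < x \<Longrightarrow> u x \<noteq> 0"
    and mass_finite: "mass u {0<..<x} < \<infinity>"
begin

lemma weighted_L2_measurable: "f \<in> weighted_L2 u \<Longrightarrow> f \<in> borel_measurable halfline"
  by (simp add: weighted_L2_def)

lemma weighted_L2_finite: "f \<in> weighted_L2 u \<Longrightarrow> (\<integral>\<^sup>+x. ennreal ((u x * f x)\<^sup>2) \<partial>halfline) < \<infinity>"
  by (simp add: weighted_L2_def in_L2_iff)

text \<open>On A one has t^k \<le> x^k, and the mass of A is enlarged to that of (0,x). The
  resulting factor depends on x alone, as the Hardy inequality requires of \<open>V\<close>.\<close>

lemma moment_increment: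
  assumes f[measurable]: "f \<in> borel_measurable halfline" and A[measurable]: "A \<in> sets borel"
    and sub: "A \<subseteq> {0<..x}"
  shows "(\<integral>\<^sup>+t\<in>A. ennreal \<bar>t ^ k * f t\<bar> \<partial>halfline)\<^sup>2
    \<le> ennreal (x ^ (2 * k)) * mass u {0<..<x} * (\<integral>\<^sup>+t\<in>A. ennreal ((u t * f t)\<^sup>2) \<partial>halfline)"
proof -
  have ind[measurable]: "(indicator A :: real \<Rightarrow> ennreal) \<in> borel_measurable halfline"
    by (rule measurable_compose[OF measurable_id_halfline]) simp
  have "(\<integral>\<^sup>+t\<in>A. ennreal \<bar>t ^ k * f t\<bar> \<partial>halfline) \<le> (\<integral>\<^sup>+t. ennreal (x ^ k) * (ennreal \<bar>f t\<bar> * indicator A t) \<partial>halfline)"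
  proof (intro nn_integral_mono)
    fix t assume "t \<in> space halfline"
    then have "0 < t" by simp
    have "ennreal \<bar>t ^ k * f t\<bar> \<le> ennreal (x ^ k) * ennreal \<bar>f t\<bar>" if "t \<in> A"
    proof -
      have "t \<le> x" using sub that by auto
      then have "\<bar>t ^ k * f t\<bar> \<le> x ^ k * \<bar>f t\<bar>"
        using \<open>0 < t\<close> unfolding abs_mult by (intro mult_right_mono) (auto intro: power_mono)
      then show ?thesis
        using \<open>0 < t\<close> \<open>t \<le> x\<close> by (simp add: ennreal_leI flip: ennreal_mult)
    qed
    then show "ennreal \<bar>t ^ k * f t\<bar> * indicator A t \<le> ennreal (x ^ k) * (ennreal \<bar>f t\<bar> * indicator A t)"
      by (cases "t \<in> A") auto
  qed
  also have "\<dots> = ennreal (x ^ k) * (\<integral>\<^sup>+t\<in>A. ennreal \<bar>f t\<bar> \<partial>halfline)"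
    by (intro nn_integral_cmult) measurable
  finally have "(\<integral>\<^sup>+t\<in>A. ennreal \<bar>t ^ k * f t\<bar> \<partial>halfline)\<^sup>2
     \<le> (ennreal (x ^ k) * (\<integral>\<^sup>+t\<in>A. ennreal \<bar>f t\<bar> \<partial>halfline))\<^sup>2"
    by (intro power_mono) auto
  also have "\<dots> = (ennreal (x ^ k))\<^sup>2 * (\<integral>\<^sup>+t\<in>A. ennreal \<bar>f t\<bar> \<partial>halfline)\<^sup>2"
    by (simp add: power_mult_distrib)
  also have "\<dots> \<le> ennreal (x ^ (2 * k)) * (mass u {0<..<x} * (\<integral>\<^sup>+t\<in>A. ennreal ((u t * f t)\<^sup>2) \<partial>halfline))"
  proof (cases "0 < x")
    case True
    have "(\<integral>\<^sup>+t\<in>A. ennreal \<bar>f t\<bar> \<partial>halfline)\<^sup>2 \<le>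
        (\<integral>\<^sup>+t\<in>A. ennreal (inverse ((u t)\<^sup>2)) \<partial>halfline) * (\<integral>\<^sup>+t\<in>A. ennreal ((u t * f t)\<^sup>2) \<partial>halfline)"
      using u_nonzero by (intro weighted_Cauchy_Schwarz) auto
    also have "(\<integral>\<^sup>+t\<in>A. ennreal (inverse ((u t)\<^sup>2)) \<partial>halfline) \<le> mass u {0<..<x}"
      using mass_mono[OF sub, of u] mass_Ioc[of 0 u x] by (simp add: mass_def)
    finally have "(\<integral>\<^sup>+t\<in>A. ennreal \<bar>f t\<bar> \<partial>halfline)\<^sup>2
      \<le> mass u {0<..<x} * (\<integral>\<^sup>+t\<in>A. ennreal ((u t * f t)\<^sup>2) \<partial>halfline)"
      by (simp add: mult_right_mono)
    then show ?thesis
      using True by (intro mult_mono) (auto simp: ennreal_power power_mult mult.commute[of 2 k])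
  next
    case False
    then have "A = {}" using sub by auto
    then show ?thesis by simp
  qed
  finally show ?thesis by (simp add: mult.assoc)
qed

lemma moment_finite:
  assumes f: "f \<in> weighted_L2 u" and A: "A \<in> sets borel" "A \<subseteq> {0<..x}"
  shows "(\<integral>\<^sup>+t\<in>A. ennreal \<bar>t ^ k * f t\<bar> \<partial>halfline) < \<infinity>"
proof -
  have "(\<integral>\<^sup>+t\<in>A. ennreal ((u t * f t)\<^sup>2) \<partial>halfline) \<le> (\<integral>\<^sup>+t. ennreal ((u t * f t)\<^sup>2) \<partial>halfline)"
    by (intro nn_integral_mono) (auto split: split_indicator)
  then have "(\<integral>\<^sup>+t\<in>A. ennreal ((u t * f t)\<^sup>2) \<partial>halfline) < \<infinity>"
    using weighted_L2_finite[OF f] by (rule le_less_trans)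
  then have "ennreal (x ^ (2 * k)) * mass u {0<..<x} * (\<integral>\<^sup>+t\<in>A. ennreal ((u t * f t)\<^sup>2) \<partial>halfline) < \<infinity>"
    using mass_finite[of x] by (auto simp: ennreal_mult_less_top)
  then have "(\<integral>\<^sup>+t\<in>A. ennreal \<bar>t ^ k * f t\<bar> \<partial>halfline)\<^sup>2 < \<infinity>"
    using moment_increment[OF weighted_L2_measurable[OF f] A] by (rule le_less_trans[rotated])
  then show ?thesis by (auto simp: power2_eq_square ennreal_mult_less_top)
qed

lemma set_integrable_moment:
  assumes f: "f \<in> weighted_L2 u" and A: "A \<in> sets borel" "A \<subseteq> {0<..x}"
  shows "set_integrable lebesgue A (\<lambda>t. t ^ k * f t)"
proof -
  have [measurable]: "f \<in> borel_measurable halfline" using weighted_L2_measurable[OF f] .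
  show ?thesis
    using A(2) by (intro set_integrable_halflineI A moment_finite[OF f A]) auto
qed

lemma set_integrable_moment_Ioo:
  "f \<in> weighted_L2 u \<Longrightarrow> set_integrable lebesgue {0<..<x} (\<lambda>t. t ^ k * f t)"
  by (rule set_integrable_moment[of _ _ x]) auto

lemma poly_kernel_op_eq_sum:
  assumes f: "f \<in> weighted_L2 u"
  shows "poly_kernel_op n a f x = (\<Sum>k\<le>n. monomial_op a k f x)"
proof -
  have int: "set_integrable lebesgue {0<..<x} (\<lambda>t. a k x * (t ^ k * f t))" for k
    by (intro set_integrable_mult_right set_integrable_moment_Ioo[OF f])
  have "poly_kernel_op n a f x = (LINT t:{0<..<x}|lebesgue. \<Sum>k\<le>n. a k x * (t ^ k * f t))"
    by (simp add: poly_kernel_op_def sum_distrib_right mult.assoc)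
  also have "\<dots> = (\<Sum>k\<le>n. LINT t:{0<..<x}|lebesgue. a k x * (t ^ k * f t))"
    using int unfolding set_integrable_def set_lebesgue_integral_def scaleR_sum_right
    by (intro Bochner_Integration.integral_sum)
  finally show ?thesis by (simp add: monomial_op_def)
qed

lemma monomial_op_measurable:
  assumes f: "f \<in> weighted_L2 u" and [measurable]: "a k \<in> borel_measurable halfline"
  shows "monomial_op a k f \<in> borel_measurable halfline"
proof -
  have [measurable]: "(\<lambda>x. LINT t:{0<..<x}|lebesgue. t ^ k * f t) \<in> borel_measurable halfline"
    by (intro borel_measurable_set_integral_Ioo set_integrable_moment_Ioo[OF f])
  have "(\<lambda>x. a k x * (LINT t:{0<..<x}|lebesgue. t ^ k * f t)) \<in> borel_measurable halfline"
    by measurable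
  then show ?thesis by (simp add: monomial_op_def[abs_def])
qed

lemma monomial_op_bounded_if_muckenhoupt:
  assumes [measurable]: "a k \<in> borel_measurable halfline" "v \<in> borel_measurable halfline"
    and B: "\<And>x. 0 < x \<Longrightarrow> ennreal (x ^ (2 * k)) * mass u {0<..<x} *
        (\<integral>\<^sup>+t\<in>{x<..}. ennreal ((a k t * v t)\<^sup>2) \<partial>halfline) \<le> ennreal B"
  shows "acts_boundedly (monomial_op a k) u v"
  unfolding acts_boundedly_iff_nn_integral[OF assms(2)]
proof (intro exI[of _ "16 * max B 0"] ballI conjI)
  fix f assume f: "f \<in> weighted_L2 u"
  show "monomial_op a k f \<in> borel_measurable halfline"
    by (rule monomial_op_measurable[OF f]) simp
  have [measurable]: "f \<in> borel_measurable halfline" using weighted_L2_measurable[OF f] .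
  \<comment> \<open>The absolute value makes F nondecreasing; F still dominates the modulus of the
    integral in \<open>monomial_op\<close>.\<close>
  define g where "g t = \<bar>t ^ k * f t\<bar>" for t
  have g: "set_integrable lebesgue A g" if "A \<in> sets borel" "A \<subseteq> {0<..x}" for A x
    unfolding g_def by (rule set_integrable_abs[OF set_integrable_moment[OF f that]])
  define F where "F x = (LINT t:{0<..<x}|lebesgue. g t)" for x
  \<comment> \<open>Half-open intervals are used so that (0,x] is exactly the disjoint union of
    (0,y] and (y,x].\<close>
  have F_nn: "ennreal (F x) = (\<integral>\<^sup>+t\<in>{0<..x}. ennreal (g t) \<partial>halfline)" if "0 \<le> x" for x
  proof -
    have "F x = (LINT t:{0<..x}|lebesgue. g t)"
      unfolding F_def using that by (subst (1 2) set_integral_eq_Icc[where x = x]) (auto intro!: g[of _ x])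
    also have "ennreal \<dots> = (\<integral>\<^sup>+t. ennreal (indicator {0<..x} t *\<^sub>R g t) \<partial>lebesgue)"
      using g[of "{0<..x}" x] unfolding set_lebesgue_integral_def set_integrable_def
      by (intro nn_integral_eq_integral[symmetric]) (auto simp: g_def)
    also have "\<dots> = (\<integral>\<^sup>+t\<in>{0<..x}. ennreal (g t) \<partial>lebesgue)"
      by (intro nn_integral_cong) (auto split: split_indicator)
    finally show ?thesis by (subst set_nn_integral_halfline) auto
  qed
  have F_nonneg: "0 \<le> F x" for x
    unfolding F_def set_lebesgue_integral_def by (intro integral_nonneg_AE) (auto simp: g_def)
  have gm[measurable]: "g \<in> borel_measurable halfline" unfolding g_def[abs_def] by measurable
  have F_diff: "ennreal (F x) = ennreal (F y) + (\<integral>\<^sup>+t\<in>{y<..x}. ennreal (g t) \<partial>halfline)" if "0 \<le> y" "y \<le> x" for x y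
  proof -
    have "(\<integral>\<^sup>+t\<in>{0<..x}. ennreal (g t) \<partial>halfline)
       = (\<integral>\<^sup>+t. ennreal (g t) * indicator {0<..y} t + ennreal (g t) * indicator {y<..x} t \<partial>halfline)"
      using that by (intro nn_integral_cong) (auto split: split_indicator)
    also have "\<dots> = (\<integral>\<^sup>+t\<in>{0<..y}. ennreal (g t) \<partial>halfline) + (\<integral>\<^sup>+t\<in>{y<..x}. ennreal (g t) \<partial>halfline)"
      by (intro nn_integral_add) measurable
    finally show ?thesis using that by (simp add: F_nn)
  qed
  have "(\<integral>\<^sup>+x. ennreal ((v x * monomial_op a k f x)\<^sup>2) \<partial>halfline)
      \<le> (\<integral>\<^sup>+x. ennreal ((a k x * v x)\<^sup>2) * ennreal ((F x)\<^sup>2) \<partial>halfline)"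
  proof (intro nn_integral_mono)
    fix x
    have "\<bar>LINT t:{0<..<x}|lebesgue. t ^ k * f t\<bar> \<le> F x"
      unfolding F_def g_def set_lebesgue_integral_def
      by (rule order_trans[OF integral_abs_bound]) (simp add: abs_mult)
    then have "\<bar>LINT t:{0<..<x}|lebesgue. t ^ k * f t\<bar>\<^sup>2 \<le> (F x)\<^sup>2"
      by (intro power_mono) auto
    then have "(a k x * v x)\<^sup>2 * (LINT t:{0<..<x}|lebesgue. t ^ k * f t)\<^sup>2 \<le> (a k x * v x)\<^sup>2 * (F x)\<^sup>2"
      by (intro mult_left_mono) auto
    then have "(v x * monomial_op a k f x)\<^sup>2 \<le> (a k x * v x)\<^sup>2 * (F x)\<^sup>2"
      by (simp add: monomial_op_def power_mult_distrib ac_simps)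
    then show "ennreal ((v x * monomial_op a k f x)\<^sup>2) \<le> ennreal ((a k x * v x)\<^sup>2) * ennreal ((F x)\<^sup>2)"
      by (simp add: ennreal_leI flip: ennreal_mult)
  qed
  also have "\<dots> \<le> 16 * ennreal B * (\<integral>\<^sup>+x. ennreal ((u x * f x)\<^sup>2) \<partial>halfline)"
  proof (rule weighted_hardy_dyadic[where V = "\<lambda>x. ennreal (x ^ (2 * k)) * mass u {0<..<x}"])
    show "continuous_on {0..} F"
      unfolding F_def using g[of "{0<..<x}" x for x] by (intro continuous_on_set_integral_Ioo) force
    show "F 0 = 0" by (simp add: F_def set_lebesgue_integral_def)
    show "F x \<le> F y" if "0 \<le> x" "x \<le> y" for x y
    proof -
      have "ennreal (F x) \<le> ennreal (F y)" unfolding F_diff[OF that] by simp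
      then show ?thesis using F_nonneg by simp
    qed
    show "ennreal ((F x - F y)\<^sup>2) \<le> ennreal (x ^ (2 * k)) * mass u {0<..<x} *
        (\<integral>\<^sup>+t\<in>{y<..x}. ennreal ((u t * f t)\<^sup>2) \<partial>halfline)" if "0 < y" "y < x" for x y
    proof -
      have "ennreal (F x - F y) = ennreal (F x) - ennreal (F y)" using F_nonneg by (simp add: ennreal_minus)
      also have "\<dots> = (\<integral>\<^sup>+t\<in>{y<..x}. ennreal (g t) \<partial>halfline)"
        using F_diff[of y x] that by simp
      finally have eq: "ennreal (F x - F y) = (\<integral>\<^sup>+t\<in>{y<..x}. ennreal (g t) \<partial>halfline)" .
      have "F y \<le> F x" using F_diff[of y x] that F_nonneg
        by (metis ennreal_le_iff le_iff_add less_imp_le)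
      then have "ennreal ((F x - F y)\<^sup>2) = (\<integral>\<^sup>+t\<in>{y<..x}. ennreal (g t) \<partial>halfline)\<^sup>2"
        by (simp add: eq flip: ennreal_power)
      moreover have "{y<..x} \<subseteq> {0<..x}" using that by auto
      ultimately show ?thesis
        unfolding g_def using moment_increment[of f "{y<..x}" x k] by simp
    qed
  qed (use B in auto)
  also have "16 * ennreal B = ennreal (16 * max B 0)"
    by (simp add: ennreal_mult max_def ennreal_neg)
  finally show "(\<integral>\<^sup>+x. ennreal ((v x * monomial_op a k f x)\<^sup>2) \<partial>halfline)
      \<le> ennreal (16 * max B 0) * (\<integral>\<^sup>+x. ennreal ((u x * f x)\<^sup>2) \<partial>halfline)" .
qed

end

section \<open>Test functions\<close>

context inverse_square_weight
begin

text \<open>The density vanishes nowhere on the half-line, so zero mass would make the interval a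
  null set. Positivity is what allows a bound on the product in the Hardy condition to be turned
  into finiteness of its tail factor.\<close>

lemma mass_pos:
  assumes "0 < r"
  shows "0 < mass u {0<..<r}"
proof (rule ccontr)
  assume "\<not> 0 < mass u {0<..<r}"
  then have "(\<integral>\<^sup>+t\<in>{0<..<r}. ennreal (inverse ((u t)\<^sup>2)) \<partial>halfline) = 0"
    by (simp add: mass_def)
  then have "AE t in halfline. ennreal (inverse ((u t)\<^sup>2)) * indicator {0<..<r} t = 0"
    by (subst (asm) nn_integral_0_iff_AE) auto
  then have "AE t in lebesgue. t \<in> {0<..} \<longrightarrow> ennreal (inverse ((u t)\<^sup>2)) * indicator {0<..<r} t = 0"
    by (subst (asm) AE_restrict_space_iff) auto
  then have "AE t in lebesgue. t \<notin> {0<..<r}"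
    using u_nonzero by (elim eventually_mono) (auto simp: indicator_def)
  then have "{0<..<r} \<in> null_sets lebesgue"
    by (subst AE_iff_null_sets) auto
  then show False using assms by (auto simp: null_sets_def)
qed

text \<open>The extremal function of Cauchy-Schwarz on A: both its integral and its squared weighted
  norm equal the mass of A.\<close>

definition test_fun :: "real set \<Rightarrow> real \<Rightarrow> real" where
  "test_fun A t = inverse ((u t)\<^sup>2) * indicator A t"

lemma test_fun_measurable [measurable]:
  "A \<in> sets borel \<Longrightarrow> test_fun A \<in> borel_measurable halfline"
proof -
  assume [measurable]: "A \<in> sets borel"
  have [measurable]: "(indicator A :: real \<Rightarrow> real) \<in> borel_measurable halfline"
    by (rule measurable_compose[OF measurable_id_halfline]) simp
  show ?thesis unfolding test_fun_def[abs_def] by measurable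
qed

lemma test_fun_energy:
  "(\<integral>\<^sup>+t. ennreal ((u t * test_fun A t)\<^sup>2) \<partial>halfline) = mass u A"
  unfolding mass_def
proof (intro nn_integral_cong)
  fix t assume "t \<in> space halfline"
  then have "u t \<noteq> 0" using u_nonzero by simp
  then show "ennreal ((u t * test_fun A t)\<^sup>2) = ennreal (inverse ((u t)\<^sup>2)) * indicator A t"
    by (simp add: test_fun_def power2_eq_square indicator_def field_simps)
qed

lemma test_fun_in_weighted_L2:
  assumes "A \<in> sets borel" "A \<subseteq> {0<..<r}"
  shows "test_fun A \<in> weighted_L2 u"
proof -
  note [measurable] = test_fun_measurable[OF assms(1)]
  have "mass u A < \<infinity>"
    using mass_mono[OF assms(2)] mass_finite by (rule le_less_trans)
  then have "(\<lambda>t. u t * test_fun A t) \<in> L2 {0<..}"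
    unfolding in_L2_iff test_fun_energy by auto
  then show ?thesis
    using test_fun_measurable[OF assms(1)] by (simp add: weighted_L2_def)
qed

text \<open>The mean value theorem for integrals with nonnegative weight, applied to the polynomial
  in t with coefficients \<open>a k x\<close>. As d \<le> x, the whole test function lies inside the
  range of integration.\<close>

lemma poly_kernel_op_test_fun:
  assumes "0 \<le> c" "c < d" "d \<le> x"
  shows "\<exists>\<tau>\<in>{c..d}. poly_kernel_op n a (test_fun {c<..<d}) x
      = (\<Sum>k\<le>n. a k x * \<tau> ^ k) * enn2real (mass u {c<..<d})"
proof -
  define f where "f = test_fun {c<..<d}"
  define P where "P t = (\<Sum>k\<le>n. a k x * t ^ k)" for t
  define m where "m = enn2real (mass u {c<..<d})"
  have f: "f \<in> weighted_L2 u"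
    unfolding f_def using assms by (intro test_fun_in_weighted_L2[of _ d]) auto
  have fnn: "0 \<le> f t" and f0: "t \<notin> {c<..<d} \<Longrightarrow> f t = 0" for t
    by (auto simp: f_def test_fun_def)
  have int1: "set_integrable lebesgue {0<..<x} f"
    using set_integrable_moment_Ioo[OF f, of x 0] by simp
  have intk: "set_integrable lebesgue {0<..<x} (\<lambda>t. a k x * (t ^ k * f t))" for k
    by (intro set_integrable_mult_right set_integrable_moment_Ioo[OF f])
  have int2: "set_integrable lebesgue {0<..<x} (\<lambda>t. P t * f t)"
    using intk
    unfolding P_def sum_distrib_right mult.assoc set_integrable_def scaleR_sum_right
    by (intro Bochner_Integration.integrable_sum)
  have m: "(LINT t:{0<..<x}|lebesgue. f t) = m"
  proof -
    have "(LINT t:{0<..<x}|lebesgue. f t) = enn2real (\<integral>\<^sup>+t. ennreal (indicator {0<..<x} t *\<^sub>R f t) \<partial>lebesgue)"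
      using int1 fnn unfolding set_lebesgue_integral_def set_integrable_def
      by (intro integral_eq_nn_integral) auto
    also have "(\<integral>\<^sup>+t. ennreal (indicator {0<..<x} t *\<^sub>R f t) \<partial>lebesgue)
        = (\<integral>\<^sup>+t\<in>{c<..<d}. ennreal (inverse ((u t)\<^sup>2)) \<partial>lebesgue)"
      using assms by (intro nn_integral_cong) (auto simp: f_def test_fun_def split: split_indicator)
    finally show ?thesis
      using assms unfolding m_def mass_def by (subst set_nn_integral_halfline) auto
  qed
  have "continuous_on {c..d} P" unfolding P_def by (intro continuous_intros)
  then obtain l h where lh: "P ` {c..d} = {l..h}" "l \<le> h"
    using continuous_image_closed_interval[of c d P] assms by auto
  have Pb: "l \<le> P t" "P t \<le> h" if "t \<in> {c<..<d}" for t
  proof -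
    have "P t \<in> {l..h}" using that lh(1) by (metis greaterThanLessThan_subseteq_atLeastAtMost_iff imageI order_refl subsetD)
    then show "l \<le> P t" "P t \<le> h" by auto
  qed
  define J where "J = (LINT t:{0<..<x}|lebesgue. P t * f t)"
  have "(LINT t:{0<..<x}|lebesgue. l * f t) \<le> J"
    unfolding J_def using Pb fnn f0
    by (intro set_integral_mono set_integrable_mult_right int1 int2) (metis mult_right_mono mult_zero_right order_refl)
  then have J1: "l * m \<le> J" by (simp add: m)
  have "J \<le> (LINT t:{0<..<x}|lebesgue. h * f t)"
    unfolding J_def using Pb fnn f0
    by (intro set_integral_mono set_integrable_mult_right int1 int2) (metis mult_right_mono mult_zero_right order_refl)
  then have J2: "J \<le> h * m" by (simp add: m)
  have "m \<ge> 0" by (simp add: m_def)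
  have "\<exists>\<tau>\<in>{c..d}. J = P \<tau> * m"
  proof (cases "m = 0")
    case True
    then show ?thesis using J1 J2 assms by (intro bexI[of _ c]) auto
  next
    case False
    then have "J / m \<in> {l..h}" using J1 J2 \<open>m \<ge> 0\<close> by (auto simp: field_simps)
    then obtain \<tau> where "\<tau> \<in> {c..d}" "P \<tau> = J / m" unfolding lh(1)[symmetric] by auto
    then show ?thesis using False by (intro bexI[of _ \<tau>]) auto
  qed
  then show ?thesis
    by (simp add: poly_kernel_op_def J_def P_def f_def m_def)
qed

end

section \<open>Doubling and the necessary condition\<close>

text \<open>Here (b/4, 3b/4) is the concentric half of (0,b). With D \<ge> 1 the powers of D
  increase, so the largest exponent serves all test intervals at once.\<close>

locale doubling_weight = inverse_square_weight +
  fixes \<delta> D :: real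
  assumes D_ge_1: "1 \<le> D"
    and doubling: "0 < b \<Longrightarrow> \<delta> \<le> b \<Longrightarrow> mass u {0<..<b} \<le> ennreal D * mass u {b/4<..<3*b/4}"
begin

text \<open>The middle half (b/4, 3b/4) lies in (0, 3b/4), so each use of doubling cuts the right
  endpoint by the factor 3/4 at the price of one D.\<close>

lemma mass_shrink:
  assumes "0 < b" "0 \<le> \<delta>" "\<delta> \<le> (3/4) ^ m * b"
  shows "mass u {0<..<b} \<le> ennreal (D ^ m) * mass u {0<..<(3/4) ^ m * b}"
  using assms(3)
proof (induction m)
  case (Suc m)
  define c where "c = (3/4) ^ m * b"
  have c: "0 < c" "\<delta> \<le> 3/4 * c" using assms(1) Suc.prems by (auto simp: c_def)
  then have "\<delta> \<le> c" by simp
  then have "mass u {0<..<b} \<le> ennreal (D ^ m) * mass u {0<..<c}" using Suc.IH by (simp add: c_def)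
  also have "\<dots> \<le> ennreal (D ^ m) * (ennreal D * mass u {c/4<..<3*c/4})"
    using doubling[OF c(1) \<open>\<delta> \<le> c\<close>] by (intro mult_left_mono) auto
  also have "\<dots> \<le> ennreal (D ^ m) * (ennreal D * mass u {0<..<3*c/4})"
    using c(1) by (intro mult_left_mono mass_mono) auto
  also have "\<dots> = ennreal (D ^ Suc m) * mass u {0<..<(3/4) ^ Suc m * b}"
    using D_ge_1 by (simp add: c_def ennreal_mult ac_simps)
  finally show ?case .
qed simp

text \<open>The lower bound on r says that even the shortest of the n + 1 intervals to which
  doubling is applied, (0, (3/4)^(4n) r), has length at least \<delta>. One B serves all such r and
  all k.\<close>

lemma muckenhoupt_tail:
  assumes a[measurable]: "\<And>k. k \<le> n \<Longrightarrow> a k \<in> borel_measurable halfline" and v[measurable]: "v \<in> borel_measurable halfline"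
    and bdd: "acts_boundedly (poly_kernel_op n a) u v" and "0 \<le> \<delta>"
  shows "\<exists>B. \<forall>r k. 0 < r \<longrightarrow> \<delta> \<le> (3/4) ^ (4 * n) * r \<longrightarrow> k \<le> n \<longrightarrow>
     ennreal (r ^ (2 * k)) * mass u {0<..<r} * (\<integral>\<^sup>+t\<in>{r<..}. ennreal ((a k t * v t)\<^sup>2) \<partial>halfline) \<le> ennreal B"
proof -
  \<comment> \<open>For j < i the gap between the test intervals is at least b_j/4 - (3/4)(81/256)
    b_j = (13/1024) b_j, where 81/256 = (3/4)^4, and b_j is at least (3/4)^(4n) r. Division by r
    gives g.\<close>
  define g :: real where "g = 13/1024 * (3/4) ^ (4 * n)"
  have "g > 0" by (simp add: g_def)
  obtain K where "K > 0" and K: "\<And>(p::real poly) \<tau> M k. degree p \<le> n \<Longrightarrow>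
      (\<And>i. i \<le> n \<Longrightarrow> 0 \<le> \<tau> i \<and> \<tau> i \<le> 1 \<and> \<bar>poly p (\<tau> i)\<bar> \<le> M) \<Longrightarrow>
      (\<And>i j. i \<le> n \<Longrightarrow> j < i \<Longrightarrow> g \<le> \<bar>\<tau> i - \<tau> j\<bar>) \<Longrightarrow> \<bar>coeff p k\<bar> \<le> K * M"
    using poly_coeff_bound_separated[OF \<open>g > 0\<close>, of n] by (metis (no_types, lifting))
  obtain C0 :: real where C0: "\<And>f. f \<in> weighted_L2 u \<Longrightarrow> poly_kernel_op n a f \<in> borel_measurable halfline"
     "\<And>f. f \<in> weighted_L2 u \<Longrightarrow>
     (\<integral>\<^sup>+x. ennreal ((v x * poly_kernel_op n a f x)\<^sup>2) \<partial>halfline) \<le> ennreal C0 * (\<integral>\<^sup>+x. ennreal ((u x * f x)\<^sup>2) \<partial>halfline)"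
    using bdd unfolding acts_boundedly_iff_nn_integral[OF v] by blast
  define C where "C = max C0 0"
  have C: "0 \<le> C" "ennreal C0 \<le> ennreal C" by (auto simp: C_def intro: ennreal_leI)
  \<comment> \<open>At most 4n doublings lead from (0,r) to (0,b_i), and one more from (0,b_i) to
    \<open>I i\<close>.\<close>
  define N where "N = D ^ (4 * n + 1)"
  have "N > 0" using D_ge_1 by (simp add: N_def)
  \<comment> \<open>The outer n + 1 counts the test functions; the inner one comes from bounding the
    square of a sum of n + 1 terms by the sum of squares.\<close>
  have main: "ennreal (r ^ (2 * k)) * mass u {0<..<r} * (\<integral>\<^sup>+t\<in>{r<..}. ennreal ((a k t * v t)\<^sup>2) \<partial>halfline)
      \<le> ennreal ((n + 1) * (K\<^sup>2 * (n + 1) * C * N))"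
    if r: "0 < r" "\<delta> \<le> (3/4) ^ (4 * n) * r" and k: "k \<le> n" for r k
  proof -
    text \<open>
      The ratio $(3/4)^4 < 1/3$ of consecutive \<open>b i\<close> makes the intervals \<open>I i\<close> pairwise separated,
      and one application of the doubling condition compares \<open>I i\<close> with $(0, b_i)$.
    \<close>
    define b where "b i = (3/4) ^ (4 * i) * r" for i :: nat
    define I where "I i = {b i / 4<..<3 * b i / 4}" for i
    define m where "m i = enn2real (mass u (I i))" for i
    define W where "W = enn2real (mass u {0<..<r})"
    have W: "mass u {0<..<r} = ennreal W" "0 < W"
      using mass_finite[of r] mass_pos[OF r(1)] by (auto simp: W_def enn2real_positive_iff)
    have b_pos: "0 < b i" for i using r by (simp add: b_def)
    have b_anti: "b j \<le> b i" if "i \<le> j" for i j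
      using that r unfolding b_def by (intro mult_right_mono power_decreasing) auto
    have b_le: "b i \<le> r" for i using b_anti[of 0 i] by (simp add: b_def)
    have b_ge: "\<delta> \<le> b i" if "i \<le> n" for i
      using r(2) b_anti[OF that] unfolding b_def by (rule order_trans)
    have I_sub: "I i \<subseteq> {0<..<r}" for i using b_pos[of i] b_le[of i] by (auto simp: I_def)
    have m: "mass u (I i) = ennreal (m i)" for i
      using le_less_trans[OF mass_mono[OF I_sub] mass_finite] by (simp add: m_def)
    have m_nonneg: "0 \<le> m i" for i by (simp add: m_def)
    have W_le: "W \<le> N * m i" if i: "i \<le> n" for i
    proof -
      have "ennreal W \<le> ennreal (D ^ (4 * i)) * mass u {0<..<b i}"
        using mass_shrink[of r "4 * i"] b_ge[OF i] r \<open>0 \<le> \<delta>\<close> by (simp add: W b_def)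
      also have "\<dots> \<le> ennreal (D ^ (4 * i)) * (ennreal D * mass u (I i))"
        unfolding I_def by (intro mult_left_mono doubling b_pos b_ge i) auto
      also have "\<dots> = ennreal (D ^ (4 * i + 1) * m i)"
        using D_ge_1 m_nonneg by (simp add: m ennreal_mult ac_simps)
      also have "\<dots> \<le> ennreal (N * m i)"
        using D_ge_1 i m_nonneg unfolding N_def
        by (intro ennreal_leI mult_right_mono power_increasing) auto
      finally show ?thesis using m_nonneg \<open>N > 0\<close> by simp
    qed
    have m_pos: "0 < m i" if "i \<le> n" for i
      using W_le[OF that] W(2) \<open>N > 0\<close> m_nonneg[of i] by (cases "m i = 0") auto
    define f where "f i = test_fun (I i)" for i
    have f: "f i \<in> weighted_L2 u" for i
      unfolding f_def using I_sub by (intro test_fun_in_weighted_L2) (auto simp: I_def)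
    define A where "A i = poly_kernel_op n a (f i)" for i
    have [measurable]: "A i \<in> borel_measurable halfline" for i unfolding A_def by (rule C0(1)[OF f])
    have A_bd: "(\<integral>\<^sup>+x. ennreal ((v x * A i x)\<^sup>2) \<partial>halfline) \<le> ennreal (C * m i)" for i
    proof -
      have "(\<integral>\<^sup>+x. ennreal ((v x * A i x)\<^sup>2) \<partial>halfline) \<le> ennreal C0 * ennreal (m i)"
        using C0(2)[OF f, of i] by (simp add: A_def f_def test_fun_energy m)
      also have "\<dots> \<le> ennreal C * ennreal (m i)" by (intro mult_right_mono C) auto
      finally show ?thesis using C m_nonneg by (simp add: ennreal_mult)
    qed
    define c where "c i = K\<^sup>2 * (n + 1) / (m i)\<^sup>2" for i
    have c_nonneg: "0 \<le> c i" for i by (simp add: c_def)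
    have pointwise: "r ^ (2 * k) * (a k x * v x)\<^sup>2 \<le> (\<Sum>i\<le>n. c i * (v x * A i x)\<^sup>2)" if x: "r < x" for x
    proof -
      have "\<forall>i. \<exists>\<tau>\<in>{b i / 4..3 * b i / 4}. A i x = (\<Sum>k\<le>n. a k x * \<tau> ^ k) * m i"
      proof
        fix i
        have "0 \<le> b i / 4" "b i / 4 < 3 * b i / 4" "3 * b i / 4 \<le> x"
          using b_pos[of i] b_le[of i] x by simp_all
        then show "\<exists>\<tau>\<in>{b i / 4..3 * b i / 4}. A i x = (\<Sum>k\<le>n. a k x * \<tau> ^ k) * m i"
          unfolding A_def f_def I_def m_def by (rule poly_kernel_op_test_fun)
      qed
      then obtain \<tau> where \<tau>: "\<And>i. \<tau> i \<in> {b i / 4..3 * b i / 4}"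
        "\<And>i. A i x = (\<Sum>k\<le>n. a k x * \<tau> i ^ k) * m i" by metis
      \<comment> \<open>The kernel polynomial in the variable s = t/r: its nodes
        \<open>\<tau> i / r\<close> lie in [0,1], and its k-th coefficient already carries
        r^k.\<close>
      define p where "p = (\<Sum>j\<le>n. monom (a j x * r ^ j) j)"
      \<comment> \<open>A sum in place of the maximum, so that M^2 is dominated by a sum of squares
        that can be integrated term by term.\<close>
      define M where "M = (\<Sum>i\<le>n. \<bar>A i x\<bar> / m i)"
      have "\<bar>coeff p k\<bar> \<le> K * M"
      proof (rule K[of p "\<lambda>i. \<tau> i / r"])
        show "degree p \<le> n" unfolding p_def
          by (intro degree_sum_le) (auto intro: order_trans[OF degree_monom_le])
        fix i assume i: "i \<le> n"
        have "poly p (\<tau> i / r) = (\<Sum>k\<le>n. a k x * \<tau> i ^ k)"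
          using r by (simp add: p_def poly_sum poly_monom power_divide)
        also have "\<dots> = A i x / m i" using \<tau>(2)[of i] m_pos[OF i] by simp
        finally have "\<bar>poly p (\<tau> i / r)\<bar> = \<bar>A i x\<bar> / m i" using m_pos[OF i] by simp
        also have "\<dots> \<le> M" unfolding M_def using i m_nonneg by (intro member_le_sum) auto
        finally show "0 \<le> \<tau> i / r \<and> \<tau> i / r \<le> 1 \<and> \<bar>poly p (\<tau> i / r)\<bar> \<le> M"
          using \<tau>(1)[of i] b_pos[of i] b_le[of i] r by (auto simp: field_simps)
        fix j assume j: "j < i"
        have bij: "b i \<le> 81/256 * b j"
          using b_anti[of "Suc j" i] j by (simp add: b_def power_add power_divide[of 3 4 4])
        have "(3/4) ^ (4 * n) * r \<le> b j"
          using b_anti[of j n] i j by (simp add: b_def)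
        then have "g * r \<le> 13/1024 * b j" by (simp add: g_def mult.commute)
        also have "\<dots> \<le> \<tau> j - \<tau> i" using \<tau>(1)[of i] \<tau>(1)[of j] bij by simp
        finally show "g \<le> \<bar>\<tau> i / r - \<tau> j / r\<bar>"
          using r by (simp add: field_simps flip: diff_divide_distrib)
      qed
      moreover have "coeff p k = a k x * r ^ k"
        using k by (simp add: p_def coeff_sum)
      ultimately have "\<bar>a k x * r ^ k\<bar>\<^sup>2 \<le> (K * M)\<^sup>2" by (intro power_mono) auto
      then have "(a k x)\<^sup>2 * r ^ (2 * k) \<le> K\<^sup>2 * M\<^sup>2"
        by (simp add: power_mult_distrib power_mult mult.commute[of 2 k])
      also have "M\<^sup>2 \<le> (\<Sum>i\<le>n. (\<bar>A i x\<bar> / m i)\<^sup>2) * real (card {..n})"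
        unfolding M_def by (rule sum_squared_le_sum_of_squares)
      finally have "(v x)\<^sup>2 * ((a k x)\<^sup>2 * r ^ (2 * k)) \<le> (v x)\<^sup>2 * (K\<^sup>2 * ((\<Sum>i\<le>n. (\<bar>A i x\<bar> / m i)\<^sup>2) * real (card {..n})))"
        by (simp add: mult_left_mono)
      also have "\<dots> = (\<Sum>i\<le>n. c i * (v x * A i x)\<^sup>2)"
        by (simp add: c_def sum_distrib_left sum_distrib_right power_mult_distrib power_divide field_simps)
      finally show ?thesis by (simp add: power_mult_distrib ac_simps)
    qed
    have [measurable]: "a k \<in> borel_measurable halfline" using a k by simp
    have "ennreal (r ^ (2 * k)) * (\<integral>\<^sup>+t\<in>{r<..}. ennreal ((a k t * v t)\<^sup>2) \<partial>halfline)
       = (\<integral>\<^sup>+t. ennreal (r ^ (2 * k)) * (ennreal ((a k t * v t)\<^sup>2) * indicator {r<..} t) \<partial>halfline)"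
      by (intro nn_integral_cmult[symmetric]) measurable
    also have "\<dots> \<le> (\<integral>\<^sup>+t. (\<Sum>i\<le>n. ennreal (c i) * ennreal ((v t * A i t)\<^sup>2)) \<partial>halfline)"
    proof (intro nn_integral_mono)
      fix t
      show "ennreal (r ^ (2 * k)) * (ennreal ((a k t * v t)\<^sup>2) * indicator {r<..} t)
        \<le> (\<Sum>i\<le>n. ennreal (c i) * ennreal ((v t * A i t)\<^sup>2))"
      proof (cases "r < t")
        case True
        have "ennreal (r ^ (2 * k)) * ennreal ((a k t * v t)\<^sup>2) = ennreal (r ^ (2 * k) * (a k t * v t)\<^sup>2)"
          using r by (simp add: ennreal_mult)
        also have "\<dots> \<le> ennreal (\<Sum>i\<le>n. c i * (v t * A i t)\<^sup>2)"
          by (intro ennreal_leI pointwise True)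
        also have "\<dots> = (\<Sum>i\<le>n. ennreal (c i) * ennreal ((v t * A i t)\<^sup>2))"
          using c_nonneg by (subst sum_ennreal[symmetric]) (auto simp: ennreal_mult)
        finally show ?thesis using True by simp
      qed simp
    qed
    also have "\<dots> = (\<Sum>i\<le>n. ennreal (c i) * (\<integral>\<^sup>+t. ennreal ((v t * A i t)\<^sup>2) \<partial>halfline))"
      by (subst nn_integral_sum) (auto simp: nn_integral_cmult)
    also have "\<dots> \<le> (\<Sum>i\<le>n. ennreal (c i) * ennreal (C * m i))"
      by (intro sum_mono mult_left_mono A_bd) auto
    finally have "ennreal W * (ennreal (r ^ (2 * k)) * (\<integral>\<^sup>+t\<in>{r<..}. ennreal ((a k t * v t)\<^sup>2) \<partial>halfline))
      \<le> ennreal W * (\<Sum>i\<le>n. ennreal (c i) * ennreal (C * m i))" by (intro mult_left_mono) auto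
    also have "\<dots> = ennreal (\<Sum>i\<le>n. W * (c i * (C * m i)))"
      using W c_nonneg C m_nonneg
      by (subst sum_ennreal[symmetric]) (auto simp: sum_distrib_left ennreal_mult)
    also have "\<dots> \<le> ennreal (\<Sum>i\<le>n. K\<^sup>2 * (n + 1) * C * N)"
    proof (intro ennreal_leI sum_mono)
      fix i assume "i \<in> {..n}"
      then have i: "i \<le> n" by simp
      \<comment> \<open>Of the two factors 1/m_i in \<open>c i\<close>, one is cancelled by the
        squared norm m_i of the test function; the other is absorbed by W \<le> N m_i.\<close>
      have "W * (c i * (C * m i)) = K\<^sup>2 * (n + 1) * C * (W / m i)"
        using m_pos[OF i] by (simp add: c_def power2_eq_square)
      also have "\<dots> \<le> K\<^sup>2 * (n + 1) * C * N"
        using W_le[OF i] m_pos[OF i] C by (intro mult_left_mono) (auto simp: field_simps)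
      finally show "W * (c i * (C * m i)) \<le> K\<^sup>2 * (n + 1) * C * N" .
    qed
    finally show ?thesis by (simp add: W ac_simps)
  qed
  then show ?thesis by blast
qed

end

text \<open>Below the threshold R, where (3/4)^(4n) R = \<delta>, the factor x^(2k) W(x) is at most
  its value at R by monotonicity. The tail from x exceeds the tail from R by at most an integral
  over a bounded interval, finite by \<open>L2\<close>; the tail from R is finite by the bound
  already proved at R.\<close>

lemma (in doubling_weight) muckenhoupt:
  assumes a: "\<And>k. k \<le> n \<Longrightarrow> a k \<in> borel_measurable halfline" and v: "v \<in> borel_measurable halfline"
    and bdd: "acts_boundedly (poly_kernel_op n a) u v" and "0 \<le> \<delta>" and k: "k \<le> n"
    and L2: "\<And>r. 0 < \<delta> \<Longrightarrow> 0 < r \<Longrightarrow> (\<lambda>x. a k x * v x) \<in> L2 {0<..<r}"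
  shows "\<exists>B. \<forall>x>0. ennreal (x ^ (2 * k)) * mass u {0<..<x} *
        (\<integral>\<^sup>+t\<in>{x<..}. ennreal ((a k t * v t)\<^sup>2) \<partial>halfline) \<le> ennreal B"
proof -
  define \<Phi> where "\<Phi> x = (\<integral>\<^sup>+t\<in>{x<..}. ennreal ((a k t * v t)\<^sup>2) \<partial>halfline)" for x
  note [measurable] = a[OF k] v
  obtain B where B: "\<And>r. 0 < r \<Longrightarrow> \<delta> \<le> (3/4) ^ (4 * n) * r \<Longrightarrow>
     ennreal (r ^ (2 * k)) * mass u {0<..<r} * \<Phi> r \<le> ennreal B"
    using muckenhoupt_tail[OF a v bdd \<open>0 \<le> \<delta>\<close>] k unfolding \<Phi>_def by blast
  show ?thesis
  proof (cases "\<delta> = 0")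
    case True
    then show ?thesis using B unfolding \<Phi>_def by (intro exI[of _ B]) auto
  next
    case False
    then have "0 < \<delta>" using \<open>0 \<le> \<delta>\<close> by simp
    define R where "R = \<delta> / (3/4) ^ (4 * n)"
    have R: "0 < R" "\<delta> = (3/4) ^ (4 * n) * R" using \<open>0 < \<delta>\<close> by (simp_all add: R_def)
    have "ennreal (R ^ (2 * k)) * mass u {0<..<R} * \<Phi> R < \<infinity>"
      using B[of R] R by (auto intro: le_less_trans)
    then have \<Phi>R: "\<Phi> R < \<infinity>"
      using mass_pos[OF R(1)] R(1) by (auto simp: ennreal_mult_less_top less_top ennreal_mult_eq_top_iff)
    \<comment> \<open>With 2R in place of R the sets (0,2R) and (R,\<infinity>) overlap, so together
      they cover the half-line including the point R.\<close>
    define Y where "Y = (\<integral>\<^sup>+t\<in>{0<..<2*R}. ennreal ((a k t * v t)\<^sup>2) \<partial>halfline)"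
    have "integrable (lebesgue_on {0<..<2*R}) (\<lambda>x. (a k x * v x)\<^sup>2)"
      using L2[OF \<open>0 < \<delta>\<close>, of "2 * R"] R by (simp add: L2_def)
    then have "(\<integral>\<^sup>+t. ennreal ((a k t * v t)\<^sup>2) \<partial>lebesgue_on {0<..<2*R}) < \<infinity>"
      by (auto simp: integrable_iff_bounded)
    then have Y: "Y < \<infinity>"
      unfolding Y_def by (subst set_nn_integral_halfline) (auto simp: nn_integral_restrict_space)
    have \<Phi>_le: "\<Phi> x \<le> Y + \<Phi> R" for x
    proof -
      have "\<Phi> x \<le> (\<integral>\<^sup>+t. ennreal ((a k t * v t)\<^sup>2) * indicator {0<..<2*R} t
           + ennreal ((a k t * v t)\<^sup>2) * indicator {R<..} t \<partial>halfline)"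
        unfolding \<Phi>_def using R(1) by (intro nn_integral_mono) (auto split: split_indicator)
      also have "\<dots> = Y + \<Phi> R"
        unfolding Y_def \<Phi>_def by (intro nn_integral_add) measurable
      finally show ?thesis .
    qed
    define X where "X = ennreal (R ^ (2 * k)) * mass u {0<..<R} * (Y + \<Phi> R)"
    have X: "X < \<infinity>" using mass_finite[of R] Y \<Phi>R by (auto simp: X_def ennreal_mult_less_top)
    show ?thesis
    proof (intro exI[of _ "max B (enn2real X)"] allI impI)
      fix x :: real assume "0 < x"
      have "ennreal (x ^ (2 * k)) * mass u {0<..<x} * \<Phi> x \<le> ennreal (max B (enn2real X))"
      proof (cases "R \<le> x")
        case True
        then have "ennreal (x ^ (2 * k)) * mass u {0<..<x} * \<Phi> x \<le> ennreal B"
          using \<open>0 < x\<close> R by (intro B) auto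
        also have "\<dots> \<le> ennreal (max B (enn2real X))" by (intro ennreal_leI) auto
        finally show ?thesis .
      next
        case False
        then have "ennreal (x ^ (2 * k)) * mass u {0<..<x} * \<Phi> x \<le> X"
          unfolding X_def using \<open>0 < x\<close>
          by (intro mult_mono \<Phi>_le mass_mono ennreal_leI power_mono) auto
        also have "X = ennreal (enn2real X)" using X by simp
        also have "\<dots> \<le> ennreal (max B (enn2real X))" by (intro ennreal_leI) auto
        finally show ?thesis .
      qed
      then show "ennreal (x ^ (2 * k)) * mass u {0<..<x} *
        (\<integral>\<^sup>+t\<in>{x<..}. ennreal ((a k t * v t)\<^sup>2) \<partial>halfline) \<le> ennreal (max B (enn2real X))"
        by (simp add: \<Phi>_def)
    qed
  qed
qed

section \<open>Assembling the two implications\<close>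

lemma (in inverse_square_weight) poly_kernel_op_bounded:
  assumes v: "v \<in> borel_measurable halfline"
    and "\<And>k. k \<le> n \<Longrightarrow> acts_boundedly (monomial_op a k) u v"
  shows "acts_boundedly (poly_kernel_op n a) u v"
  using assms(2)
proof (induction n)
  case 0
  show ?case
    by (rule acts_boundedly_linear_combination[OF v 0 0, where c = 0])
      (simp_all add: poly_kernel_op_eq_sum)
next
  case (Suc n)
  show ?case
    by (rule acts_boundedly_linear_combination[OF v Suc.IH Suc.prems[of "Suc n"], where c = 1])
      (simp_all add: Suc.prems poly_kernel_op_eq_sum)
qed

text \<open>Local summability controls only compact subsets of the open half-line. Finite mass up to
  0 follows because [c/4, 3c/4] is such a set and doubling compares (0,c) with it; c is taken
  positive, at least \<delta> and at least x.\<close>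

lemma doubling_weight_of_B_class:
  assumes u: "u \<in> borel_measurable halfline" and "0 \<le> \<delta>"
    and B: "(\<lambda>x. inverse ((u x)\<^sup>2)) \<in> B_class \<delta>"
  shows "\<exists>D. doubling_weight u \<delta> D"
proof -
  from B have pos: "\<And>x. 0 < x \<Longrightarrow> 0 < inverse ((u x)\<^sup>2)"
    and loc: "locally_summable (\<lambda>x. inverse ((u x)\<^sup>2))"
    unfolding B_class_def by blast+
  from B obtain D0 where D0: "\<forall>a b. 0 \<le> a \<and> a < b \<and> \<delta> \<le> b - a \<longrightarrow>
        (\<integral>\<^sup>+x\<in>{a<..<b}. ennreal (inverse ((u x)\<^sup>2)) \<partial>lebesgue)
          \<le> ennreal D0 * (\<integral>\<^sup>+x\<in>{(3*a + b)/4 <..< (a + 3*b)/4}. ennreal (inverse ((u x)\<^sup>2)) \<partial>lebesgue)"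
    unfolding B_class_def by blast
  define D where "D = max D0 1"
  have doubling: "mass u {0<..<b} \<le> ennreal D * mass u {b/4<..<3*b/4}" if "0 < b" "\<delta> \<le> b" for b
  proof -
    have "mass u {0<..<b} \<le> ennreal D0 * mass u {b/4<..<3*b/4}"
      using D0[rule_format, of 0 b] that unfolding mass_def
      by (subst (1 2) set_nn_integral_halfline) auto
    also have "\<dots> \<le> ennreal D * mass u {b/4<..<3*b/4}"
      by (intro mult_right_mono ennreal_leI) (auto simp: D_def)
    finally show ?thesis .
  qed
  have fin: "mass u {0<..<x} < \<infinity>" for x
  proof -
    define c where "c = \<bar>x\<bar> + \<delta> + 1"
    have c: "0 < c" "\<delta> \<le> c" "x \<le> c" using \<open>0 \<le> \<delta>\<close> by (auto simp: c_def)
    have "{c/4..3*c/4} \<subseteq> {0<..}" using c by auto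
    then have "set_integrable lebesgue {c/4..3*c/4} (\<lambda>x. inverse ((u x)\<^sup>2))"
      using loc[unfolded locally_summable_def, rule_format, of "{c/4..3*c/4}"] by simp
    then have "(\<integral>\<^sup>+t. ennreal (norm (indicator {c/4..3*c/4} t *\<^sub>R inverse ((u t)\<^sup>2))) \<partial>lebesgue) < \<infinity>"
      unfolding set_integrable_def integrable_iff_bounded by blast
    also have "(\<integral>\<^sup>+t. ennreal (norm (indicator {c/4..3*c/4} t *\<^sub>R inverse ((u t)\<^sup>2))) \<partial>lebesgue) = mass u {c/4..3*c/4}"
      unfolding mass_def using c
      by (subst set_nn_integral_halfline) (auto intro!: nn_integral_cong split: split_indicator)
    finally have "mass u {c/4..3*c/4} < \<infinity>" .
    moreover have "mass u {0<..<x} \<le> mass u {0<..<c}" using c by (intro mass_mono) auto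
    moreover have "mass u {0<..<c} \<le> ennreal D * mass u {c/4..3*c/4}"
      using doubling[OF c(1,2)] by (rule order_trans) (intro mult_left_mono mass_mono, auto)
    ultimately show ?thesis
      by (auto simp: ennreal_mult_less_top intro: le_less_trans order_trans)
  qed
  have "doubling_weight u \<delta> D"
  proof
    \<comment> \<open>Since \<open>inverse 0 = 0\<close>, positivity of the inverse square excludes
      a zero of u.\<close>
    show "u x \<noteq> 0" if "0 < x" for x using pos[OF that] by auto
  qed (use u fin doubling in \<open>auto simp: D_def\<close>)
  then show ?thesis ..
qed

theorem theorem1:
  fixes n :: nat and u v :: "real \<Rightarrow> real" and a :: "nat \<Rightarrow> real \<Rightarrow> real" and \<delta> :: real
  assumes "weight u" and "weight v"
    and "\<And>k. k \<le> n \<Longrightarrow> a k \<in> borel_measurable (lebesgue_on {0<..})"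
    and "0 \<le> \<delta>"
    and "(\<lambda>x. inverse ((u x)\<^sup>2)) \<in> B_class \<delta>"
    and "\<And>r k. 0 < \<delta> \<Longrightarrow> 0 < r \<Longrightarrow> k < n \<Longrightarrow> (\<lambda>x. a k x * v x) \<in> L2 {0<..<r}"
  shows "acts_boundedly (poly_kernel_op n a) u v
    \<longleftrightarrow> (\<forall>k\<le>n. acts_boundedly (monomial_op a k) u v)"
proof -
  have u: "u \<in> borel_measurable halfline" and v: "v \<in> borel_measurable halfline"
    using assms(1,2) by (auto simp: weight_def)
  obtain D where "doubling_weight u \<delta> D"
    using doubling_weight_of_B_class[OF u assms(4,5)] by blast
  then interpret doubling_weight u \<delta> D .
  show ?thesis
  proof
    assume "\<forall>k\<le>n. acts_boundedly (monomial_op a k) u v"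
    then show "acts_boundedly (poly_kernel_op n a) u v"
      by (intro poly_kernel_op_bounded v) auto
  next
    assume bdd: "acts_boundedly (poly_kernel_op n a) u v"
    have lower: "acts_boundedly (monomial_op a k) u v" if k: "k < n" for k
    proof -
      obtain B where "\<And>x. 0 < x \<Longrightarrow> ennreal (x ^ (2 * k)) * mass u {0<..<x} *
        (\<integral>\<^sup>+t\<in>{x<..}. ennreal ((a k t * v t)\<^sup>2) \<partial>halfline) \<le> ennreal B"
        using muckenhoupt[OF assms(3) v bdd assms(4), of k] k assms(6)[OF _ _ k] by auto
      then show ?thesis
        using k by (intro monomial_op_bounded_if_muckenhoupt assms(3) v) auto
    qed
    \<comment> \<open>For \<delta> > 0, square integrability near 0 is assumed only for k < n, so
      the Hardy condition is out of reach for k = n. The last operator is the difference of two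
      bounded ones; for n = 0 it is the given operator itself.\<close>
    have "acts_boundedly (monomial_op a n) u v"
    proof (cases n)
      case 0
      show ?thesis
        by (rule acts_boundedly_linear_combination[OF v bdd bdd, where c = 0])
          (simp_all add: poly_kernel_op_eq_sum 0)
    next
      case (Suc m)
      have "acts_boundedly (poly_kernel_op m a) u v"
        using lower Suc by (intro poly_kernel_op_bounded v) auto
      then show ?thesis
        by (rule acts_boundedly_linear_combination[OF v bdd, where c = "-1"])
          (simp_all add: poly_kernel_op_eq_sum Suc)
    qed
    then show "\<forall>k\<le>n. acts_boundedly (monomial_op a k) u v"
      using lower by (metis le_neq_implies_less)
  qed
qed

end
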